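(* Let $(S,\mathcal{A},\mu)$ be a complete, $\sigma$-finite measure space, $E$ a Köthe function space over $(S,\mathcal{A},\mu)$, and $X$ a real Banach space such that the simple functions are dense in $E(X)$. If $X$ has the local diameter-two-property (resp. the diameter-two-property), then $E(X)$ also has the local diameter-two-property (resp. the diameter-two-property). In particular, if $p\in[1,\infty)$ and $X$ has the local diameter-two-property (resp. diameter-two-property), then so does $L^p(\mu,X)$. Further, if $X$ has the strong diameter-two-property, then $L^1(\mu,X)$ also has the strong diameter-two-property.
   Context: For a real Banach space $X$, $x^*\in S_{X^*}$ and $\alpha>0$, the slice is $S(x^*,\alpha)=\{z\in B_X:x^*(z)>1-\alpha\}$. $X$ has the local diameter-two-property (LD2P) if every slice of $B_X$ has diameter 2; the diameter-two-property (D2P) if every nonempty relatively weakly open subset of $B_X$ has diameter 2; the strong diameter-two-property (SD2P) if every convex combination of slices of $B_X$ has diameter 2. Köthe function space over $(S,\mathcal{A},\mu)$: a Banach space $(E,\|\cdot\|_E)$ of real-valued measurable functions on $S$ (modulo a.e. equality) such that $\chi_A\in E$ whenever $\mu(A)<\infty$; every $f\in E$ is integrable over every set of finite measure; and if $g$ is measurable, $f\in E$ and $|g|\le|f|$ a.e., then $g\in E$ and $\|g\|_E\le\|f\|_E$. A function $f:S\to X$ is simple if it is constant on each of finitely many disjoint measurable sets of finite measure and zero outside their union; Bochner-measurable if it is an a.e. limit of simple functions. $E(X)$ is the space of Bochner-measurable $f:S\to X$ (modulo a.e.) with $\|f(\cdot)\|\in E$, normed by $\|f\|=\|\,\|f(\cdot)\|\,\|_E$.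 $L^p(\mu,X)$ denotes the Lebesgue–Bochner spaces.
   Formalization: For the diameter-two-property claims (for E(X) and for L^p(μ,X)) the measure is additionally assumed nonzero, μ(S)>0; if μ=0 these spaces are {0}, whose unit ball has diameter 0, so the claim fails. *)

theory Defs
  imports "HOL-Analysis.Analysis" "HOL-Library.Function_Algebras"
begin

instantiation "fun" :: (type, real_vector) real_vector
begin
definition scaleR_fun :: "real \<Rightarrow> ('a \<Rightarrow> 'b) \<Rightarrow> 'a \<Rightarrow> 'b"
  where "scaleR_fun r f = (\<lambda>x. r *\<^sub>R f x)"
instance by standard (auto simp: scaleR_fun_def fun_eq_iff scaleR_add_right scaleR_add_left)
end

text \<open>Elements of V are representatives; the space is V modulo N-null vectors.
  For a genuine Banach space X one takes V = UNIV and N = norm.\<close>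

definition unit_ball :: "'v::real_vector set \<Rightarrow> ('v \<Rightarrow> real) \<Rightarrow> 'v set" where
  "unit_ball V N = {v \<in> V. N v \<le> 1}"

definition dual_fun :: "'v::real_vector set \<Rightarrow> ('v \<Rightarrow> real) \<Rightarrow> ('v \<Rightarrow> real) \<Rightarrow> bool" where
  "dual_fun V N \<phi> \<longleftrightarrow>
     (\<forall>u\<in>V. \<forall>v\<in>V. \<forall>a b. \<phi> (a *\<^sub>R u + b *\<^sub>R v) = a * \<phi> u + b * \<phi> v) \<and>
     (\<exists>C. \<forall>v\<in>V. \<bar>\<phi> v\<bar> \<le> C * N v)"

definition dual_norm :: "'v::real_vector set \<Rightarrow> ('v \<Rightarrow> real) \<Rightarrow> ('v \<Rightarrow> real) \<Rightarrow> real" where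
  "dual_norm V N \<phi> = Sup {\<phi> v | v. v \<in> unit_ball V N}"

definition slice :: "'v::real_vector set \<Rightarrow> ('v \<Rightarrow> real) \<Rightarrow> ('v \<Rightarrow> real) \<Rightarrow> real \<Rightarrow> 'v set" where
  "slice V N \<phi> \<alpha> = {z \<in> unit_ball V N. \<phi> z > 1 - \<alpha>}"

definition set_diam :: "('v::real_vector \<Rightarrow> real) \<Rightarrow> 'v set \<Rightarrow> real" where
  "set_diam N W = Sup {N (y - z) | y z. y \<in> W \<and> z \<in> W}"

definition rel_weakly_open :: "'v::real_vector set \<Rightarrow> ('v \<Rightarrow> real) \<Rightarrow> 'v set \<Rightarrow> bool" where
  "rel_weakly_open V N W \<longleftrightarrow> W \<subseteq> unit_ball V N \<and>
     (\<forall>x\<in>W. \<exists>F \<epsilon>. finite F \<and> (\<forall>\<phi>\<in>F. dual_fun V N \<phi>) \<and> \<epsilon> > 0 \<and>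
        {y \<in> unit_ball V N. \<forall>\<phi>\<in>F. \<bar>\<phi> y - \<phi> x\<bar> < \<epsilon>} \<subseteq> W)"

definition LD2P :: "'v::real_vector set \<Rightarrow> ('v \<Rightarrow> real) \<Rightarrow> bool" where
  "LD2P V N \<longleftrightarrow> (\<forall>\<phi> \<alpha>. dual_fun V N \<phi> \<and> dual_norm V N \<phi> = 1 \<and> \<alpha> > 0 \<longrightarrow>
      set_diam N (slice V N \<phi> \<alpha>) = 2)"

definition D2P :: "'v::real_vector set \<Rightarrow> ('v \<Rightarrow> real) \<Rightarrow> bool" where
  "D2P V N \<longleftrightarrow> (\<forall>W. rel_weakly_open V N W \<and> W \<noteq> {} \<longrightarrow> set_diam N W = 2)"

definition SD2P :: "'v::real_vector set \<Rightarrow> ('v \<Rightarrow> real) \<Rightarrow> bool" where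
  "SD2P V N \<longleftrightarrow> (\<forall>(n::nat) (w::nat \<Rightarrow> real) \<phi> \<alpha>.
      n \<ge> 1 \<and> (\<forall>i<n. w i \<ge> 0) \<and> (\<Sum>i<n. w i) = 1 \<and>
      (\<forall>i<n. dual_fun V N (\<phi> i) \<and> dual_norm V N (\<phi> i) = 1 \<and> \<alpha> i > 0) \<longrightarrow>
      set_diam N {\<Sum>i<n. w i *\<^sub>R z i | z. \<forall>i<n. z i \<in> slice V N (\<phi> i) (\<alpha> i)} = 2)"

text \<open>E is a set of representatives (real-valued measurable functions) with norm NE;
  the Banach space is E modulo a.e. equality.\<close>
definition kothe_space :: "'s measure \<Rightarrow> ('s \<Rightarrow> real) set \<Rightarrow> (('s \<Rightarrow> real) \<Rightarrow> real) \<Rightarrow> bool" where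
  "kothe_space M E NE \<longleftrightarrow>
     E \<subseteq> borel_measurable M \<and>
     (\<forall>f\<in>E. \<forall>g\<in>E. f + g \<in> E) \<and> (\<forall>f\<in>E. \<forall>c. c *\<^sub>R f \<in> E) \<and>
     (\<forall>f\<in>E. \<forall>g\<in>E. NE (f + g) \<le> NE f + NE g) \<and>
     (\<forall>f\<in>E. \<forall>c. NE (c *\<^sub>R f) = \<bar>c\<bar> * NE f) \<and>
     (\<forall>f\<in>E. NE f = 0 \<longleftrightarrow> (AE s in M. f s = 0)) \<and>
     (\<forall>u. (\<forall>n. u n \<in> E) \<and> (\<forall>\<epsilon>>0. \<exists>K. \<forall>m\<ge>K. \<forall>n\<ge>K. NE (u m - u n) < \<epsilon>) \<longrightarrow>
          (\<exists>v\<in>E. (\<lambda>n. NE (u n - v)) \<longlonglongrightarrow> 0)) \<and>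
     (\<forall>A\<in>sets M. emeasure M A < \<infinity> \<longrightarrow> indicator A \<in> E) \<and>
     (\<forall>f\<in>E. \<forall>A\<in>sets M. emeasure M A < \<infinity> \<longrightarrow> set_integrable M A f) \<and>
     (\<forall>f\<in>E. \<forall>g\<in>borel_measurable M. (AE s in M. \<bar>g s\<bar> \<le> \<bar>f s\<bar>) \<longrightarrow> g \<in> E \<and> NE g \<le> NE f)"

definition simple_vfun :: "'s measure \<Rightarrow> ('s \<Rightarrow> 'x::real_normed_vector) \<Rightarrow> bool" where
  "simple_vfun M g \<longleftrightarrow> (\<exists>(n::nat) (A::nat \<Rightarrow> 's set) (c::nat \<Rightarrow> 'x).
      (\<forall>i<n. A i \<in> sets M \<and> emeasure M (A i) < \<infinity>) \<and> disjoint_family_on A {..<n} \<and>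
      (\<forall>s. g s = (\<Sum>i<n. indicator (A i) s *\<^sub>R c i)))"

definition bochner_measurable :: "'s measure \<Rightarrow> ('s \<Rightarrow> 'x::real_normed_vector) \<Rightarrow> bool" where
  "bochner_measurable M f \<longleftrightarrow>
     (\<exists>u. (\<forall>n. simple_vfun M (u n)) \<and> (AE s in M. (\<lambda>n. u n s) \<longlonglongrightarrow> f s))"

definition kothe_bochner :: "'s measure \<Rightarrow> ('s \<Rightarrow> real) set \<Rightarrow> ('s \<Rightarrow> 'x::real_normed_vector) set" where
  "kothe_bochner M E = {f. bochner_measurable M f \<and> (\<lambda>s. norm (f s)) \<in> E}"

definition kothe_bochner_norm :: "(('s \<Rightarrow> real) \<Rightarrow> real) \<Rightarrow> ('s \<Rightarrow> 'x::real_normed_vector) \<Rightarrow> real" where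
  "kothe_bochner_norm NE f = NE (\<lambda>s. norm (f s))"

definition simple_dense :: "'s measure \<Rightarrow> (('s \<Rightarrow> 'x::real_normed_vector) \<Rightarrow> real) \<Rightarrow> ('s \<Rightarrow> 'x) set \<Rightarrow> bool" where
  "simple_dense M N V \<longleftrightarrow> (\<forall>f\<in>V. \<forall>\<epsilon>>0. \<exists>g\<in>V. simple_vfun M g \<and> N (f - g) < \<epsilon>)"

definition Lp_bochner :: "'s measure \<Rightarrow> real \<Rightarrow> ('s \<Rightarrow> 'x::real_normed_vector) set" where
  "Lp_bochner M p = {f. bochner_measurable M f \<and> integrable M (\<lambda>s. norm (f s) powr p)}"

definition Lp_bochner_norm :: "'s measure \<Rightarrow> real \<Rightarrow> ('s \<Rightarrow> 'x::real_normed_vector) \<Rightarrow> real" where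
  "Lp_bochner_norm M p f = (\<integral>s. norm (f s) powr p \<partial>M) powr (1 / p)"

end

theory Submission
  imports Defs
begin

text \<open>
  By density, a functional on \<open>E(X)\<close> almost attains its norm at a simple function
  \<open>g = \<Sum>\<^sub>i 1\<^bsub>A i\<^esub> c\<^sub>i\<close> of norm close to 1. On each piece it induces the functional
  \<open>c \<mapsto> \<phi> (1\<^bsub>A i\<^esub> c)\<close> of \<open>X\<close>, and the diameter two property of \<open>X\<close> replaces \<open>c\<^sub>i\<close> by
  \<open>u\<^sub>i, v\<^sub>i\<close> of no larger norm, almost the same value under that functional, and distance almost
  \<open>2 \<parallel>c\<^sub>i\<parallel>\<close>. Solidity of the norm of \<open>E\<close> transfers these estimates to the two new simple functions.
  For the weak topology one first moves along a large vector on which the finitely many functionals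
  almost vanish until the unit sphere is reached. For convex combinations of slices in \<open>L\<^sup>1\<close> one
  takes a common refinement of the simple functions and uses on each piece a convex combination in
  \<open>X\<close> with weights proportional to \<open>w\<^sub>i \<parallel>c\<^sub>i\<parallel>\<close>; additivity of the \<open>L\<^sup>1\<close> norm on nonnegative
  functions sums up the estimates.
\<close>

section \<open>Seminormed subspaces\<close>

text \<open>Functions stand for their classes modulo null functions, so all spaces are treated as
  subspaces with a seminorm; one locale serves X, the scalar space E and E(X). A functional is
  bounded by a multiple of the seminorm and therefore respects null vectors. Two obstacles shape the
  argument. The hypotheses on slices speak of functionals of norm one, whereas the functional
  induced on a piece may vanish; then every point of the ball is admissible, yet some slice is still
  needed to produce two points far apart. A nonzero functional coming from another piece supplies
  it. Moreover, replacing the values of g yields functions at distance almost 2 N(g) only, so N(g)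
  has to be close to 1. In a slice this is automatic, because a functional of norm one that is large
  at g forces it; a weak neighbourhood may consist of points of small norm, whence the detour to the
  unit sphere.\<close>

locale seminormed_subspace =
  fixes V :: "'v::real_vector set" and N :: "'v \<Rightarrow> real"
  assumes zero_mem: "0 \<in> V"
    and add_mem: "u \<in> V \<Longrightarrow> v \<in> V \<Longrightarrow> u + v \<in> V"
    and scale_mem: "u \<in> V \<Longrightarrow> a *\<^sub>R u \<in> V"
    and triangle: "u \<in> V \<Longrightarrow> v \<in> V \<Longrightarrow> N (u + v) \<le> N u + N v"
    and homogeneous: "u \<in> V \<Longrightarrow> N (a *\<^sub>R u) = \<bar>a\<bar> * N u"
begin

lemma minus_mem: "u \<in> V \<Longrightarrow> - u \<in> V"
  using scale_mem[of u "-1"] by simp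

lemma diff_mem: "u \<in> V \<Longrightarrow> v \<in> V \<Longrightarrow> u - v \<in> V"
  using add_mem[of u "- v"] minus_mem by simp

lemma seminorm_zero: "N 0 = 0"
  using homogeneous[OF zero_mem, of 0] by simp

lemma seminorm_minus: "u \<in> V \<Longrightarrow> N (- u) = N u"
  using homogeneous[of u "-1"] by simp

lemma triangle_diff: "u \<in> V \<Longrightarrow> v \<in> V \<Longrightarrow> N (u - v) \<le> N u + N v"
  using triangle[of u "- v"] minus_mem seminorm_minus by simp

lemma seminorm_diff_commute: "u \<in> V \<Longrightarrow> v \<in> V \<Longrightarrow> N (u - v) = N (v - u)"
  using seminorm_minus[OF diff_mem, of v u] by simp

lemma seminorm_le_add_diff: "u \<in> V \<Longrightarrow> v \<in> V \<Longrightarrow> N u \<le> N v + N (u - v)"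
  using triangle[of v "u - v"] diff_mem by simp

lemma seminorm_nonneg: "u \<in> V \<Longrightarrow> N u \<ge> 0"
  using triangle[of u "- u"] minus_mem seminorm_minus seminorm_zero by force

lemma sum_mem: "(\<And>i. i \<in> I \<Longrightarrow> f i \<in> V) \<Longrightarrow> sum f I \<in> V"
  by (induction I rule: infinite_finite_induct) (auto simp: zero_mem add_mem)

lemma seminorm_sum_le: "(\<And>i. i \<in> I \<Longrightarrow> f i \<in> V) \<Longrightarrow> N (sum f I) \<le> (\<Sum>i\<in>I. N (f i))"
proof (induction I rule: infinite_finite_induct)
  case (insert x F)
  have "N (f x + sum f F) \<le> N (f x) + N (sum f F)"
    using insert.prems by (intro triangle sum_mem) auto
  moreover have "N (sum f F) \<le> (\<Sum>i\<in>F. N (f i))"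
    using insert by auto
  ultimately show ?case using insert.hyps by simp
qed (auto simp: seminorm_zero)

section \<open>Functionals, dual norm, slices and diameters\<close>

lemma dual_fun_scale:
  assumes "dual_fun V N \<phi>" "u \<in> V" shows "\<phi> (a *\<^sub>R u) = a * \<phi> u"
proof -
  have "\<phi> (a *\<^sub>R u + 0 *\<^sub>R u) = a * \<phi> u + 0 * \<phi> u"
    using assms unfolding dual_fun_def by blast
  then show ?thesis by simp
qed

lemma dual_fun_zero: "dual_fun V N \<phi> \<Longrightarrow> \<phi> 0 = 0"
  using dual_fun_scale[OF _ zero_mem, of \<phi> 0] by simp

lemma dual_fun_add:
  assumes "dual_fun V N \<phi>" "u \<in> V" "v \<in> V" shows "\<phi> (u + v) = \<phi> u + \<phi> v"
proof -
  have "\<phi> (1 *\<^sub>R u + 1 *\<^sub>R v) = 1 * \<phi> u + 1 * \<phi> v"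
    using assms unfolding dual_fun_def by blast
  then show ?thesis by simp
qed

lemma dual_fun_diff:
  assumes "dual_fun V N \<phi>" "u \<in> V" "v \<in> V" shows "\<phi> (u - v) = \<phi> u - \<phi> v"
  using dual_fun_add[OF assms(1) assms(2) minus_mem[OF assms(3)]]
    dual_fun_scale[OF assms(1,3), of "-1"] by simp

lemma dual_fun_sum:
  assumes "dual_fun V N \<phi>" "\<And>i. i \<in> I \<Longrightarrow> f i \<in> V"
  shows "\<phi> (sum f I) = (\<Sum>i\<in>I. \<phi> (f i))"
  using assms(2)
proof (induction I rule: infinite_finite_induct)
  case (insert x F)
  have "\<phi> (f x + sum f F) = \<phi> (f x) + \<phi> (sum f F)"
    using insert.prems by (intro dual_fun_add assms(1) sum_mem) auto
  then show ?case using insert by simp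
qed (auto simp: dual_fun_zero assms(1))

lemma dual_fun_bounded:
  assumes "dual_fun V N \<phi>"
  obtains C where "C > 0" "\<And>v. v \<in> V \<Longrightarrow> \<bar>\<phi> v\<bar> \<le> C * N v"
proof -
  obtain C where C: "\<forall>v\<in>V. \<bar>\<phi> v\<bar> \<le> C * N v"
    using assms unfolding dual_fun_def by blast
  have "\<bar>\<phi> v\<bar> \<le> (\<bar>C\<bar> + 1) * N v" if "v \<in> V" for v
  proof -
    have "C * N v \<le> (\<bar>C\<bar> + 1) * N v"
      using seminorm_nonneg[OF that] by (intro mult_right_mono) auto
    then show ?thesis using C that by force
  qed
  then show ?thesis using that[of "\<bar>C\<bar> + 1"] by auto
qed

lemma dual_norm_upper:
  assumes "dual_fun V N \<phi>" "v \<in> unit_ball V N"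
  shows "\<phi> v \<le> dual_norm V N \<phi>"
proof -
  obtain C where C: "C > 0" "\<And>v. v \<in> V \<Longrightarrow> \<bar>\<phi> v\<bar> \<le> C * N v"
    using dual_fun_bounded[OF assms(1)] by blast
  have "\<phi> u \<le> C" if "u \<in> unit_ball V N" for u
  proof -
    have "C * N u \<le> C * 1"
      using that C(1) by (intro mult_left_mono) (auto simp: unit_ball_def)
    then show ?thesis using C(2)[of u] that by (auto simp: unit_ball_def)
  qed
  then have "bdd_above {\<phi> v | v. v \<in> unit_ball V N}"
    by (auto intro!: bdd_aboveI[of _ C])
  then show ?thesis
    unfolding dual_norm_def using assms(2) by (intro cSup_upper) auto
qed

lemma zero_in_unit_ball: "0 \<in> unit_ball V N"
  by (simp add: unit_ball_def zero_mem seminorm_zero)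

lemma dual_norm_approx:
  assumes "b < dual_norm V N \<phi>"
  obtains v where "v \<in> unit_ball V N" "b < \<phi> v"
proof -
  have "{\<phi> v | v. v \<in> unit_ball V N} \<noteq> {}"
    using zero_in_unit_ball by auto
  then show ?thesis
    using less_cSupE[of b "{\<phi> v | v. v \<in> unit_ball V N}"] assms that
    unfolding dual_norm_def by blast
qed

lemma dual_fun_le_dual_norm:
  assumes "dual_fun V N \<phi>" "v \<in> V"
  shows "\<phi> v \<le> dual_norm V N \<phi> * N v"
proof (cases "N v = 0")
  case True
  \<comment> \<open>A null vector cannot be normalised, but the bound \<open>C * N v\<close> makes
    the functional vanish there.\<close>
  then show ?thesis using assms unfolding dual_fun_def by force
next
  case False
  then have pos: "N v > 0" using seminorm_nonneg[OF assms(2)] by simp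
  have "(1 / N v) *\<^sub>R v \<in> unit_ball V N"
    using pos assms(2) by (simp add: unit_ball_def scale_mem homogeneous)
  from dual_norm_upper[OF assms(1) this] show ?thesis
    using pos by (simp add: dual_fun_scale[OF assms] field_simps)
qed

lemma slice_nonempty:
  assumes "dual_norm V N \<phi> = 1" "\<alpha> > 0" shows "slice V N \<phi> \<alpha> \<noteq> {}"
  using dual_norm_approx[of "1 - \<alpha>" \<phi>] assms by (auto simp: slice_def)

text \<open>Prepares functionals for slices, which require norm one. The bound by the dual norm,
  applied to x and to -x, shows that one nonzero value already makes the dual norm positive.\<close>

lemma dual_norm_normalized:
  assumes "dual_fun V N \<psi>" "x \<in> V" "\<psi> x \<noteq> 0"
  shows "dual_norm V N \<psi> > 0"
    and "dual_fun V N (\<lambda>v. \<psi> v / dual_norm V N \<psi>)"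
    and "dual_norm V N (\<lambda>v. \<psi> v / dual_norm V N \<psi>) = 1"
proof -
  let ?r = "dual_norm V N \<psi>"
  have "\<psi> x \<le> ?r * N x" "- \<psi> x \<le> ?r * N x"
    using dual_fun_le_dual_norm[OF assms(1,2)] dual_fun_le_dual_norm[OF assms(1) minus_mem[OF assms(2)]]
      dual_fun_scale[OF assms(1,2), of "-1"] seminorm_minus[OF assms(2)] by simp_all
  then have "?r * N x > 0" using assms(3) by linarith
  then show r: "?r > 0" using seminorm_nonneg[OF assms(2)]
    by (simp add: zero_less_mult_iff)
  show "dual_fun V N (\<lambda>v. \<psi> v / ?r)"
  proof -
    obtain C where C: "\<forall>v\<in>V. \<bar>\<psi> v\<bar> \<le> C * N v"
      using assms(1) unfolding dual_fun_def by blast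
    have "\<forall>v\<in>V. \<bar>\<psi> v / ?r\<bar> \<le> (C / ?r) * N v"
      using C r by (auto simp: abs_divide divide_right_mono)
    moreover have "\<forall>u\<in>V. \<forall>v\<in>V. \<forall>a b. \<psi> (a *\<^sub>R u + b *\<^sub>R v) / ?r = a * (\<psi> u / ?r) + b * (\<psi> v / ?r)"
      using assms(1) by (simp add: dual_fun_def add_divide_distrib)
    ultimately show ?thesis unfolding dual_fun_def by blast
  qed
  show "dual_norm V N (\<lambda>v. \<psi> v / ?r) = 1"
    unfolding dual_norm_def[of V N "\<lambda>v. \<psi> v / ?r"]
  proof (rule cSup_eq_non_empty)
    show "{\<psi> v / ?r | v. v \<in> unit_ball V N} \<noteq> {}"
      using zero_in_unit_ball by auto
    show "y \<le> 1" if "y \<in> {\<psi> v / ?r | v. v \<in> unit_ball V N}" for y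
      using that r dual_norm_upper[OF assms(1)] by auto
    show "1 \<le> b" if b: "\<And>y. y \<in> {\<psi> v / ?r | v. v \<in> unit_ball V N} \<Longrightarrow> y \<le> b" for b
    proof (rule ccontr)
      assume "\<not> 1 \<le> b"
      then have "b * ?r < ?r" using r by simp
      then obtain v where v: "v \<in> unit_ball V N" "b * ?r < \<psi> v"
        using dual_norm_approx by blast
      with b[of "\<psi> v / ?r"] r show False by (auto simp: field_simps)
    qed
  qed
qed

lemma set_diam_eq_2I:
  assumes "W \<subseteq> unit_ball V N"
    and "\<And>\<epsilon>. \<epsilon> > 0 \<Longrightarrow> \<exists>y\<in>W. \<exists>z\<in>W. N (y - z) > 2 - \<epsilon>"
  shows "set_diam N W = 2"
  unfolding set_diam_def
proof (rule cSup_eq_non_empty)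
  show "{N (y - z) | y z. y \<in> W \<and> z \<in> W} \<noteq> {}"
    using assms(2)[of 1] by auto
  fix x assume "x \<in> {N (y - z) | y z. y \<in> W \<and> z \<in> W}"
  then obtain y z where yz: "x = N (y - z)" "y \<in> W" "z \<in> W" by blast
  then have "y \<in> V" "z \<in> V" "N y \<le> 1" "N z \<le> 1"
    using assms(1) by (auto simp: unit_ball_def)
  then show "x \<le> 2" using triangle_diff[of y z] yz(1) by simp
next
  fix b assume b: "\<And>x. x \<in> {N (y - z) | y z. y \<in> W \<and> z \<in> W} \<Longrightarrow> x \<le> b"
  show "2 \<le> b"
  proof (rule ccontr)
    assume "\<not> 2 \<le> b"
    then obtain y z where "y \<in> W" "z \<in> W" "N (y - z) > 2 - (2 - b)"
      using assms(2)[of "2 - b"] by auto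
    moreover from this have "N (y - z) \<le> b" by (intro b) auto
    ultimately show False by simp
  qed
qed

lemma unit_ball_convex_sum:
  fixes w :: "nat \<Rightarrow> real"
  assumes "\<And>i. i < n \<Longrightarrow> w i \<ge> 0" "(\<Sum>i<n. w i) = 1" "\<And>i. i < n \<Longrightarrow> z i \<in> unit_ball V N"
  shows "(\<Sum>i<n. w i *\<^sub>R z i) \<in> unit_ball V N"
proof -
  have V: "z i \<in> V" "N (z i) \<le> 1" if "i < n" for i
    using assms(3)[OF that] by (auto simp: unit_ball_def)
  have "N (\<Sum>i<n. w i *\<^sub>R z i) \<le> (\<Sum>i<n. N (w i *\<^sub>R z i))"
    using V by (intro seminorm_sum_le scale_mem) auto
  also have "\<dots> \<le> (\<Sum>i<n. w i)"
  proof (rule sum_mono)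
    fix i assume "i \<in> {..<n}"
    then show "N (w i *\<^sub>R z i) \<le> w i"
      using V[of i] assms(1)[of i] mult_left_mono[of "N (z i)" 1 "w i"] by (simp add: homogeneous)
  qed
  finally show ?thesis
    using assms(2) V by (auto simp: unit_ball_def intro!: sum_mem scale_mem)
qed

lemma weak_neighbourhood_rel_open:
  assumes "finite F" "\<And>\<phi>. \<phi> \<in> F \<Longrightarrow> dual_fun V N \<phi>"
  shows "rel_weakly_open V N {y \<in> unit_ball V N. \<forall>\<phi>\<in>F. \<bar>\<phi> y - \<phi> x\<bar> < \<epsilon>}"
  unfolding rel_weakly_open_def
proof (intro conjI ballI)
  fix y assume "y \<in> {y \<in> unit_ball V N. \<forall>\<phi>\<in>F. \<bar>\<phi> y - \<phi> x\<bar> < \<epsilon>}"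
  then have y: "\<bar>\<phi> y - \<phi> x\<bar> < \<epsilon>" if "\<phi> \<in> F" for \<phi> using that by auto
  \<comment> \<open>The smallest slack left at y among the finitely many conditions; the entry 1
    keeps the minimum meaningful for empty F.\<close>
  define \<eta> where "\<eta> = Min (insert 1 ((\<lambda>\<phi>. \<epsilon> - \<bar>\<phi> y - \<phi> x\<bar>) ` F))"
  have \<eta>: "\<eta> > 0" "\<And>\<phi>. \<phi> \<in> F \<Longrightarrow> \<eta> \<le> \<epsilon> - \<bar>\<phi> y - \<phi> x\<bar>"
    using assms(1) y by (auto simp: \<eta>_def)
  have "\<bar>\<phi> z - \<phi> x\<bar> < \<epsilon>" if "\<phi> \<in> F" "\<bar>\<phi> z - \<phi> y\<bar> < \<eta>" for z \<phi>
    using \<eta>(2)[OF that(1)] that(2) by linarith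
  then show "\<exists>G \<eta>. finite G \<and> (\<forall>\<phi>\<in>G. dual_fun V N \<phi>) \<and> \<eta> > 0 \<and>
      {z \<in> unit_ball V N. \<forall>\<phi>\<in>G. \<bar>\<phi> z - \<phi> y\<bar> < \<eta>} \<subseteq> {y \<in> unit_ball V N. \<forall>\<phi>\<in>F. \<bar>\<phi> y - \<phi> x\<bar> < \<epsilon>}"
    using assms \<eta>(1) by (intro exI[of _ F] exI[of _ \<eta>]) auto
qed auto

end

lemma set_diam_eq_2D:
  assumes "set_diam N W = 2" "W \<noteq> {}" "\<epsilon> > 0"
  obtains y z where "y \<in> W" "z \<in> W" "N (y - z) > 2 - \<epsilon>"
proof -
  let ?D = "{N (y - z) | y z. y \<in> W \<and> z \<in> W}"
  have "2 - \<epsilon> < Sup ?D" "?D \<noteq> {}"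
    using assms by (auto simp: set_diam_def)
  then obtain x where "x \<in> ?D" "2 - \<epsilon> < x"
    by (rule less_cSupE)
  then show ?thesis using that by blast
qed

interpretation norm: seminormed_subspace "UNIV :: 'x::real_normed_vector set" norm
  by standard (auto intro: norm_triangle_ineq)

section \<open>Moving points of a Banach space\<close>

text \<open>Divided by \<open>r * norm c\<close>, the threshold \<open>\<psi> c - \<delta>\<close>
  becomes the level \<open>1 - \<alpha>\<close> for the normalised functional; it lies below 1
  because \<open>\<psi> c\<close> is at most \<open>r * norm c\<close>. If c or
  \<open>\<psi>\<close> is zero, every y satisfies the inequality, and the auxiliary functional only
  provides some slice.\<close>

lemma slice_around:
  fixes \<psi> \<psi>\<^sub>0 :: "'x::real_normed_vector \<Rightarrow> real"
  assumes "dual_fun UNIV norm \<psi>" "dual_fun UNIV norm \<psi>\<^sub>0" "\<psi>\<^sub>0 x\<^sub>0 \<noteq> 0" "\<delta> > 0"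
  shows "\<exists>\<xi> \<alpha>. dual_fun UNIV norm \<xi> \<and> dual_norm UNIV norm \<xi> = 1 \<and> \<alpha> > 0 \<and>
    (\<forall>y\<in>slice UNIV norm \<xi> \<alpha>. \<psi> (norm c *\<^sub>R y) > \<psi> c - \<delta>)"
proof (cases "c \<noteq> 0 \<and> (\<exists>x. \<psi> x \<noteq> 0)")
  case True
  then obtain x where x: "\<psi> x \<noteq> 0" and c: "c \<noteq> 0" by blast
  define r where "r = dual_norm UNIV norm \<psi>"
  note n = norm.dual_norm_normalized[OF assms(1) _ x, simplified, folded r_def]
  define \<alpha> where "\<alpha> = 1 - (\<psi> c - \<delta>) / (r * norm c)"
  have "\<psi> c - \<delta> < r * norm c"
    using norm.dual_fun_le_dual_norm[OF assms(1), of c] assms(4) by (simp add: r_def)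
  then have "\<alpha> > 0" using n(1) c by (simp add: \<alpha>_def)
  moreover have "\<psi> (norm c *\<^sub>R y) > \<psi> c - \<delta>" if "y \<in> slice UNIV norm (\<lambda>v. \<psi> v / r) \<alpha>" for y
  proof -
    have "(\<psi> c - \<delta>) / (r * norm c) < \<psi> y / r"
      using that by (simp add: slice_def \<alpha>_def)
    then have "(\<psi> c - \<delta>) / (r * norm c) * (r * norm c) < \<psi> y / r * (r * norm c)"
      using n(1) c by (intro mult_strict_right_mono) auto
    then have "\<psi> c - \<delta> < norm c * \<psi> y"
      using n(1) c by (simp add: mult.commute)
    then show ?thesis by (simp add: norm.dual_fun_scale[OF assms(1)])
  qed
  ultimately show ?thesis using n by blast
next
  case False
  then have "\<psi> (norm c *\<^sub>R y) > \<psi> c - \<delta>" for y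
    using assms(4) norm.dual_fun_zero[OF assms(1)] by (auto simp: norm.dual_fun_scale[OF assms(1)])
  then show ?thesis
    using norm.dual_norm_normalized(2,3)[OF assms(2) UNIV_I assms(3)]
    by (intro exI[of _ "\<lambda>v. \<psi>\<^sub>0 v / dual_norm UNIV norm \<psi>\<^sub>0"] exI[of _ "1::real"]) simp
qed

lemma norm_scaled_diff:
  fixes c y z :: "'x::real_normed_vector"
  assumes "norm (y - z) > 2 - \<epsilon>"
  shows "norm (norm c *\<^sub>R y - norm c *\<^sub>R z) \<ge> (2 - \<epsilon>) * norm c"
proof -
  have "norm (norm c *\<^sub>R y - norm c *\<^sub>R z) = norm (y - z) * norm c"
    by (simp flip: scaleR_diff_right)
  then show ?thesis using assms by (simp add: mult_right_mono)
qed

lemma LD2P_move: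
  fixes \<psi> \<psi>\<^sub>0 :: "'x::real_normed_vector \<Rightarrow> real"
  assumes "LD2P (UNIV :: 'x set) norm" "dual_fun UNIV norm \<psi>"
    and "dual_fun UNIV norm \<psi>\<^sub>0" "\<psi>\<^sub>0 x\<^sub>0 \<noteq> 0" "\<delta> > 0" "\<epsilon> > 0"
  shows "\<exists>u v. norm u \<le> norm c \<and> norm v \<le> norm c \<and> \<psi> u > \<psi> c - \<delta> \<and> \<psi> v > \<psi> c - \<delta> \<and>
    norm (u - v) \<ge> (2 - \<epsilon>) * norm c"
proof -
  obtain \<xi> \<alpha> where \<xi>: "dual_fun UNIV norm \<xi>" "dual_norm UNIV norm \<xi> = 1" "\<alpha> > 0"
    "\<And>y. y \<in> slice UNIV norm \<xi> \<alpha> \<Longrightarrow> \<psi> (norm c *\<^sub>R y) > \<psi> c - \<delta>"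
    using slice_around[OF assms(2-5)] by blast
  then have "set_diam norm (slice UNIV norm \<xi> \<alpha>) = 2"
    using assms(1) unfolding LD2P_def by blast
  then obtain y z where yz: "y \<in> slice UNIV norm \<xi> \<alpha>" "z \<in> slice UNIV norm \<xi> \<alpha>" "norm (y - z) > 2 - \<epsilon>"
    using set_diam_eq_2D[OF _ norm.slice_nonempty[OF \<xi>(2,3)] assms(6)] by blast
  then have "norm (norm c *\<^sub>R y) \<le> norm c" "norm (norm c *\<^sub>R z) \<le> norm c"
    by (auto simp: slice_def unit_ball_def mult_left_le)
  then show ?thesis
    using \<xi>(4) yz norm_scaled_diff[OF yz(3), of c] by blast
qed

text \<open>Scaling by \<open>norm c\<close> carries weak neighbourhoods of \<open>sgn c\<close> to
  weak neighbourhoods of c, whence the radius \<open>\<delta> / norm c\<close>. Weak neighbourhoods,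
  unlike slices, admit zero functionals, so nothing has to be normalised.\<close>

lemma D2P_move:
  fixes \<psi> :: "'i \<Rightarrow> 'x::real_normed_vector \<Rightarrow> real"
  assumes "D2P (UNIV :: 'x set) norm" "finite F" "\<And>i. i \<in> F \<Longrightarrow> dual_fun UNIV norm (\<psi> i)"
    and "\<delta> > 0" "\<epsilon> > 0"
  shows "\<exists>u v. norm u \<le> norm c \<and> norm v \<le> norm c \<and> (\<forall>i\<in>F. \<bar>\<psi> i u - \<psi> i c\<bar> < \<delta> \<and> \<bar>\<psi> i v - \<psi> i c\<bar> < \<delta>) \<and>
    norm (u - v) \<ge> (2 - \<epsilon>) * norm c"
proof (cases "c = 0")
  case True
  then show ?thesis using assms(4) by (intro exI[of _ c]) auto
next
  case False
  define W where "W = {y \<in> unit_ball UNIV norm. \<forall>\<phi>\<in>\<psi> ` F. \<bar>\<phi> y - \<phi> (sgn c)\<bar> < \<delta> / norm c}"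
  have "rel_weakly_open UNIV norm W"
    unfolding W_def using assms(2,3) by (intro norm.weak_neighbourhood_rel_open) auto
  moreover have "sgn c \<in> W"
    using False assms(4) by (auto simp: W_def unit_ball_def norm_sgn)
  ultimately obtain y z where yz: "y \<in> W" "z \<in> W" "norm (y - z) > 2 - \<epsilon>"
    using assms(1,5) set_diam_eq_2D[of norm W \<epsilon>] unfolding D2P_def by blast
  have *: "norm (norm c *\<^sub>R y) \<le> norm c \<and> (\<forall>i\<in>F. \<bar>\<psi> i (norm c *\<^sub>R y) - \<psi> i c\<bar> < \<delta>)" if "y \<in> W" for y
  proof (intro conjI ballI)
    show "norm (norm c *\<^sub>R y) \<le> norm c"
      using that by (auto simp: W_def unit_ball_def mult_left_le)
    fix i assume i: "i \<in> F"
    have "\<psi> i (norm c *\<^sub>R y) - \<psi> i c = \<psi> i (norm c *\<^sub>R y) - \<psi> i (norm c *\<^sub>R sgn c)"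
      using False by (simp add: sgn_div_norm)
    also have "\<dots> = norm c * (\<psi> i y - \<psi> i (sgn c))"
      using norm.dual_fun_scale[OF assms(3)[OF i]] by (simp add: right_diff_distrib)
    finally have "\<bar>\<psi> i (norm c *\<^sub>R y) - \<psi> i c\<bar> = norm c * \<bar>\<psi> i y - \<psi> i (sgn c)\<bar>"
      by (simp add: abs_mult)
    moreover have "\<bar>\<psi> i y - \<psi> i (sgn c)\<bar> < \<delta> / norm c"
      using that i by (auto simp: W_def)
    ultimately show "\<bar>\<psi> i (norm c *\<^sub>R y) - \<psi> i c\<bar> < \<delta>"
      using False by (simp add: pos_less_divide_eq mult.commute)
  qed
  show ?thesis
    using *[OF yz(1)] *[OF yz(2)] norm_scaled_diff[OF yz(3), of c] by blast
qed

text \<open>The vector is the difference of two distant points in a weak neighbourhood of 0: each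
  functional is below \<open>\<delta> / 2\<close> at both points.\<close>

lemma D2P_large_near_kernel:
  fixes \<psi> :: "'i \<Rightarrow> 'x::real_normed_vector \<Rightarrow> real"
  assumes "D2P (UNIV :: 'x set) norm" "finite F" "\<And>i. i \<in> F \<Longrightarrow> dual_fun UNIV norm (\<psi> i)" "\<delta> > 0"
  obtains x where "norm x \<ge> 1" "\<And>i. i \<in> F \<Longrightarrow> \<bar>\<psi> i x\<bar> < \<delta>"
proof -
  define W where "W = {y \<in> unit_ball UNIV norm. \<forall>\<phi>\<in>\<psi> ` F. \<bar>\<phi> y - \<phi> 0\<bar> < \<delta> / 2}"
  have "rel_weakly_open UNIV norm W"
    unfolding W_def using assms(2,3) by (intro norm.weak_neighbourhood_rel_open) auto
  moreover have "0 \<in> W" using assms(4) by (auto simp: W_def unit_ball_def)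
  ultimately have "set_diam norm W = 2" "W \<noteq> {}"
    using assms(1) unfolding D2P_def by blast+
  then obtain y z where yz: "y \<in> W" "z \<in> W" "norm (y - z) > 2 - 1"
    using zero_less_one by (rule set_diam_eq_2D)
  have "\<bar>\<psi> i (y - z)\<bar> < \<delta>" if "i \<in> F" for i
  proof -
    have "\<bar>\<psi> i y - \<psi> i 0\<bar> < \<delta> / 2" "\<bar>\<psi> i z - \<psi> i 0\<bar> < \<delta> / 2"
      using yz that by (auto simp: W_def)
    then show ?thesis using norm.dual_fun_diff[OF assms(3)[OF that] UNIV_I UNIV_I, of y z] by linarith
  qed
  with yz(3) that[of "y - z"] show ?thesis by auto
qed

lemma SD2P_move:
  fixes \<psi> :: "nat \<Rightarrow> 'x::real_normed_vector \<Rightarrow> real" and \<psi>\<^sub>0 :: "'x \<Rightarrow> real"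
  assumes "SD2P (UNIV :: 'x set) norm" "n \<ge> 1" "\<And>i. i < n \<Longrightarrow> w i \<ge> 0"
    and "\<And>i. i < n \<Longrightarrow> dual_fun UNIV norm (\<psi> i)"
    and "dual_fun UNIV norm \<psi>\<^sub>0" "\<psi>\<^sub>0 x\<^sub>0 \<noteq> 0" "\<delta> > 0" "\<epsilon> > 0"
  shows "\<exists>u v. (\<forall>i<n. norm (u i) \<le> norm (c i) \<and> norm (v i) \<le> norm (c i) \<and>
      \<psi> i (u i) > \<psi> i (c i) - \<delta> \<and> \<psi> i (v i) > \<psi> i (c i) - \<delta>) \<and>
    norm (\<Sum>i<n. w i *\<^sub>R (u i - v i)) \<ge> (2 - \<epsilon>) * (\<Sum>i<n. w i * norm (c i))"
proof -
  define s where "s = (\<Sum>i<n. w i * norm (c i))"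
  have "s \<ge> 0" unfolding s_def using assms(3) by (intro sum_nonneg) auto
  then consider "s = 0" | "s > 0" by linarith
  then show ?thesis
  proof cases
    case 1
    then show ?thesis
      \<comment> \<open>The required distance is 0 here, so \<open>u = v = c\<close> will
        do.\<close>
      using assms(7) by (intro exI[of _ c]) (auto simp: s_def)
  next
    case 2
    have "\<forall>i\<in>{..<n}. \<exists>\<xi> \<alpha>. dual_fun UNIV norm \<xi> \<and> dual_norm UNIV norm \<xi> = 1 \<and> \<alpha> > 0 \<and>
        (\<forall>y\<in>slice UNIV norm \<xi> \<alpha>. \<psi> i (norm (c i) *\<^sub>R y) > \<psi> i (c i) - \<delta>)"
      using slice_around[OF assms(4-7)] by blast
    then obtain \<xi> \<alpha> where \<xi>: "\<And>i. i < n \<Longrightarrow> dual_fun UNIV norm (\<xi> i)"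
      "\<And>i. i < n \<Longrightarrow> dual_norm UNIV norm (\<xi> i) = 1" "\<And>i. i < n \<Longrightarrow> \<alpha> i > (0::real)"
      "\<And>i y. i < n \<Longrightarrow> y \<in> slice UNIV norm (\<xi> i) (\<alpha> i) \<Longrightarrow> \<psi> i (norm (c i) *\<^sub>R y) > \<psi> i (c i) - \<delta>"
      unfolding bchoice_iff by auto
    \<comment> \<open>Chosen so that \<open>w i * norm (c i) = s * l i\<close>: the combination of
      the rescaled points is then s times a convex combination of points of slices.\<close>
    define l where "l i = w i * norm (c i) / s" for i
    define W where "W = {\<Sum>i<n. l i *\<^sub>R z i | z. \<forall>i<n. z i \<in> slice UNIV norm (\<xi> i) (\<alpha> i)}"
    have "l i \<ge> 0" if "i < n" for i using assms(3)[OF that] 2 by (simp add: l_def)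
    moreover have "(\<Sum>i<n. l i) = 1"
      using 2 by (simp add: l_def s_def flip: sum_divide_distrib)
    ultimately have "set_diam norm W = 2"
      using assms(1) \<xi>(1-3) \<open>n \<ge> 1\<close> unfolding SD2P_def W_def by blast
    moreover have "W \<noteq> {}"
    proof -
      have "\<forall>i\<in>{..<n}. \<exists>z. z \<in> slice UNIV norm (\<xi> i) (\<alpha> i)"
        using norm.slice_nonempty[OF \<xi>(2,3)] by blast
      then show ?thesis unfolding bchoice_iff W_def by auto
    qed
    ultimately obtain a b where ab: "a \<in> W" "b \<in> W" "norm (a - b) > 2 - \<epsilon>"
      using set_diam_eq_2D assms(8) by blast
    obtain y z where y: "a = (\<Sum>i<n. l i *\<^sub>R y i)" "\<And>i. i < n \<Longrightarrow> y i \<in> slice UNIV norm (\<xi> i) (\<alpha> i)"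
      and z: "b = (\<Sum>i<n. l i *\<^sub>R z i)" "\<And>i. i < n \<Longrightarrow> z i \<in> slice UNIV norm (\<xi> i) (\<alpha> i)"
      using ab(1,2) unfolding W_def by blast
    have "w i *\<^sub>R (norm (c i) *\<^sub>R y i - norm (c i) *\<^sub>R z i) = s *\<^sub>R (l i *\<^sub>R y i - l i *\<^sub>R z i)" for i
      using 2 by (simp add: l_def scaleR_diff_right)
    then have "(\<Sum>i<n. w i *\<^sub>R (norm (c i) *\<^sub>R y i - norm (c i) *\<^sub>R z i))
        = (\<Sum>i<n. s *\<^sub>R (l i *\<^sub>R y i - l i *\<^sub>R z i))"
      by (rule sum.cong[OF refl])
    also have "\<dots> = s *\<^sub>R (a - b)"
      by (simp only: y(1) z(1) scaleR_sum_right scaleR_diff_right sum_subtractf)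
    finally have "(\<Sum>i<n. w i *\<^sub>R (norm (c i) *\<^sub>R y i - norm (c i) *\<^sub>R z i)) = s *\<^sub>R (a - b)" .
    then have "norm (\<Sum>i<n. w i *\<^sub>R (norm (c i) *\<^sub>R y i - norm (c i) *\<^sub>R z i)) \<ge> (2 - \<epsilon>) * s"
      using ab(3) 2 mult_right_mono[of "2 - \<epsilon>" "norm (a - b)" s] by (simp add: mult.commute)
    moreover have "norm (norm (c i) *\<^sub>R x) \<le> norm (c i)" if "x \<in> slice UNIV norm (\<xi> i) (\<alpha> i)" for i x
      using that by (auto simp: slice_def unit_ball_def mult_left_le)
    ultimately show ?thesis
      unfolding s_def using \<xi>(4) y(2) z(2)
      by (intro exI[of _ "\<lambda>i. norm (c i) *\<^sub>R y i"] exI[of _ "\<lambda>i. norm (c i) *\<^sub>R z i"]) auto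
  qed
qed

section \<open>Functions with finitely many values\<close>

text \<open>Labels in an arbitrary type, rather than vectors, so that a common refinement of several
  simple functions is again such a function, with tuples as labels.\<close>
definition finite_label :: "'s measure \<Rightarrow> ('s \<Rightarrow> 'b) \<Rightarrow> 'b \<Rightarrow> bool" where
  "finite_label M T z \<longleftrightarrow> finite (range T) \<and> (\<forall>t. t \<noteq> z \<longrightarrow> T -` {t} \<in> fmeasurable M)"

lemma finite_label_finite: "finite_label M T z \<Longrightarrow> finite (range T - {z})"
  by (simp add: finite_label_def)

lemma finite_label_fibre: "finite_label M T z \<Longrightarrow> t \<noteq> z \<Longrightarrow> T -` {t} \<in> fmeasurable M"
  by (simp add: finite_label_def)

text \<open>Fibres over other labels are measurable, hence inside \<open>space M\<close>. This
  controls the points of the type that lie outside the measure space, where functions are defined as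
  well.\<close>

lemma finite_label_outside:
  assumes "finite_label M T z" "s \<notin> space M" shows "T s = z"
proof (rule ccontr)
  assume "T s \<noteq> z"
  then have "T -` {T s} \<in> sets M"
    using finite_label_fibre[OF assms(1)] by blast
  then show False using sets.sets_into_space assms(2) by blast
qed

lemma finite_label_Collect_eq:
  assumes "finite_label M T z" shows "{s \<in> space M. T s = t} \<in> sets M"
proof -
  have *: "{s \<in> space M. T s = t} = T -` {t}" if "t \<noteq> z" for t
    using finite_label_outside[OF assms] that by auto
  show ?thesis
  proof (cases "t = z")
    case True
    have "{s \<in> space M. T s = z} = space M - (\<Union>t\<in>range T - {z}. T -` {t})" by auto
    moreover have "\<dots> \<in> sets M"
      using finite_label_finite[OF assms] finite_label_fibre[OF assms]
      by (intro sets.Diff sets.top sets.finite_UN) auto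
    ultimately show ?thesis using True by simp
  qed (use * finite_label_fibre[OF assms] in auto)
qed

lemma finite_label_simple_function: "finite_label M T z \<Longrightarrow> simple_function M T"
  unfolding simple_function_def
proof (intro conjI ballI)
  assume T: "finite_label M T z"
  then show "finite (T ` space M)"
    unfolding finite_label_def by (meson finite_subset image_mono subset_UNIV)
  fix t
  have "T -` {t} \<inter> space M = {s \<in> space M. T s = t}" by auto
  then show "T -` {t} \<inter> space M \<in> sets M"
    using finite_label_Collect_eq[OF T] by simp
qed

lemma fmeasurable_finite_UN:
  assumes "finite I" "\<And>i. i \<in> I \<Longrightarrow> A i \<in> fmeasurable M"
  shows "(\<Union>i\<in>I. A i) \<in> fmeasurable M"
  using assms by (intro fmeasurable.finite_UN) auto

lemma finite_label_map:
  assumes "finite_label M T z" "h z = y"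
  shows "finite_label M (\<lambda>s. h (T s)) y"
  unfolding finite_label_def
proof (intro conjI allI impI)
  have "range (\<lambda>s. h (T s)) = h ` range T" by auto
  then show "finite (range (\<lambda>s. h (T s)))"
    using assms(1) by (simp add: finite_label_def)
  fix t assume "t \<noteq> y"
  then have "(\<lambda>s. h (T s)) -` {t} = (\<Union>a\<in>{a \<in> range T - {z}. h a = t}. T -` {a})"
    using assms(2) by auto
  moreover have "\<dots> \<in> fmeasurable M"
    using finite_label_finite[OF assms(1)] finite_label_fibre[OF assms(1)]
    by (intro fmeasurable_finite_UN) auto
  ultimately show "(\<lambda>s. h (T s)) -` {t} \<in> fmeasurable M" by simp
qed

lemma finite_label_restrict:
  assumes "finite_label M T z" "B \<in> sets M"
  shows "finite_label M (\<lambda>s. if s \<in> B then T s else z) z"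
  unfolding finite_label_def
proof (intro conjI allI impI)
  have "range (\<lambda>s. if s \<in> B then T s else z) \<subseteq> insert z (range T)" by auto
  then show "finite (range (\<lambda>s. if s \<in> B then T s else z))"
    using assms(1) unfolding finite_label_def by (meson finite_insert finite_subset)
  fix t assume t: "t \<noteq> z"
  then have "(\<lambda>s. if s \<in> B then T s else z) -` {t} = T -` {t} \<inter> B"
    by (auto split: if_splits)
  then show "(\<lambda>s. if s \<in> B then T s else z) -` {t} \<in> fmeasurable M"
    using fmeasurable_Int_fmeasurable[OF finite_label_fibre[OF assms(1) t] assms(2)] by simp
qed

text \<open>The common refinement. A nonzero tuple has a nonzero entry k below n, so its fibre sits
  inside a fibre of \<open>f k\<close>, which has finite measure. Padding with 0 keeps the range
  finite and makes the zero tuple the exceptional label.\<close>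

lemma finite_label_tuple:
  fixes f :: "nat \<Rightarrow> 's \<Rightarrow> 'b::zero"
  assumes "\<And>i. i < n \<Longrightarrow> finite_label M (f i) 0"
  shows "finite_label M (\<lambda>s i. if i < n then f i s else 0) (\<lambda>i. 0)"
  unfolding finite_label_def
proof (intro conjI allI impI)
  let ?T = "\<lambda>s i. if i < n then f i s else 0"
  \<comment> \<open>Elements of \<open>PiE\<close> are \<open>undefined\<close> outside
    \<open>{..<n}\<close>; resetting these entries to 0 gives the padded tuples.\<close>
  have "range ?T \<subseteq> (\<lambda>g i. if i < n then g i else 0) ` (PiE {..<n} (\<lambda>i. range (f i)))"
  proof
    fix t assume "t \<in> range ?T"
    then obtain s where "t = ?T s" by blast
    then show "t \<in> (\<lambda>g i. if i < n then g i else 0) ` (PiE {..<n} (\<lambda>i. range (f i)))"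
      by (intro image_eqI[of _ _ "\<lambda>i\<in>{..<n}. f i s"]) auto
  qed
  moreover have "finite (PiE {..<n} (\<lambda>i. range (f i)))"
    using assms by (intro finite_PiE) (auto simp: finite_label_def)
  ultimately show "finite (range ?T)" by (meson finite_imageI finite_subset)
  fix t :: "nat \<Rightarrow> 'b" assume "t \<noteq> (\<lambda>i. 0)"
  then obtain k where k: "t k \<noteq> 0" by auto
  show "?T -` {t} \<in> fmeasurable M"
  proof (cases "\<exists>i\<ge>n. t i \<noteq> 0")
    case True
    then obtain i where i: "i \<ge> n" "t i \<noteq> 0" by blast
    have "?T s \<noteq> t" for s using fun_cong[of "?T s" t i] i by auto
    then have "?T -` {t} = {}" by blast
    then show ?thesis by simp
  next
    case False
    then have kn: "k < n" using k by (meson not_le)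
    have "?T -` {t} = f k -` {t k} \<inter> {s \<in> space M. \<forall>i\<in>{..<n}. f i s = t i}"
    proof (intro set_eqI iffI)
      fix s assume "s \<in> ?T -` {t}"
      then have T: "?T s = t" by simp
      have "f i s = t i" if "i < n" for i
        using that by (simp flip: T)
      moreover from this[OF kn] have "s \<in> space M"
        using finite_label_outside[OF assms[OF kn]] k by metis
      ultimately show "s \<in> f k -` {t k} \<inter> {s \<in> space M. \<forall>i\<in>{..<n}. f i s = t i}"
        using kn by auto
    next
      fix s assume "s \<in> f k -` {t k} \<inter> {s \<in> space M. \<forall>i\<in>{..<n}. f i s = t i}"
      then have "?T s = t" using False by (intro ext) auto
      then show "s \<in> ?T -` {t}" by simp
    qed
    moreover have "\<dots> \<in> fmeasurable M"
      using finite_label_fibre[OF assms[OF kn] k] finite_label_Collect_eq[OF assms]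
      by (intro fmeasurable_Int_fmeasurable sets.sets_Collect_finite_All) auto
    ultimately show ?thesis by simp
  qed
qed

lemma indicator_sum_disjoint:
  fixes c :: "'i \<Rightarrow> 'x::real_vector"
  assumes "finite I" "j \<in> I" "s \<in> A j" "\<And>i. i \<in> I \<Longrightarrow> i \<noteq> j \<Longrightarrow> s \<notin> A i"
  shows "(\<Sum>i\<in>I. indicator (A i) s *\<^sub>R c i) = c j"
proof -
  have "(\<Sum>i\<in>I. indicator (A i) s *\<^sub>R c i) = (\<Sum>i\<in>I. if i = j then c j else 0)"
    using assms by (intro sum.cong) auto
  then show ?thesis using assms by simp
qed

text \<open>The fibre over z may have infinite measure; \<open>h z = 0\<close> is what allows
  leaving it out of the sum.\<close>

lemma finite_label_decompose:
  fixes h :: "'b \<Rightarrow> 'x::real_vector"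
  assumes "finite_label M T z" "h z = 0"
  shows "h (T s) = (\<Sum>t\<in>range T - {z}. indicator (T -` {t}) s *\<^sub>R h t)"
proof (cases "T s = z")
  case True
  then have "(\<Sum>t\<in>range T - {z}. indicator (T -` {t}) s *\<^sub>R h t) = 0"
    by (intro sum.neutral) auto
  then show ?thesis using True assms(2) by simp
next
  case False
  then show ?thesis
    by (intro indicator_sum_disjoint[symmetric] finite_label_finite[OF assms(1)]) auto
qed

text \<open>Several pieces of a simple function may carry the same value, so a fibre is a finite
  union of pieces. Conversely, the enumerated nonzero values serve as coefficients and their fibres
  as pieces.\<close>

lemma simple_vfun_iff: "simple_vfun M g \<longleftrightarrow> finite_label M g 0"
proof
  assume "simple_vfun M g"
  then obtain n :: nat and A c where n: "\<forall>i<n. A i \<in> sets M \<and> emeasure M (A i) < \<infinity>"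
    and disj: "disjoint_family_on A {..<n}"
    and "\<forall>s. g s = (\<Sum>i<n. indicator (A i) s *\<^sub>R c i)"
    unfolding simple_vfun_def by blast
  then have g: "g s = (\<Sum>i<n. indicator (A i) s *\<^sub>R c i)" for s by blast
  have A: "A i \<in> fmeasurable M" if "i < n" for i
    using n that by (simp add: fmeasurable_def)
  have eq: "g s = c j" if "j < n" "s \<in> A j" for s j
    unfolding g
  proof (rule indicator_sum_disjoint)
    show "s \<notin> A i" if "i \<in> {..<n}" "i \<noteq> j" for i
      using disjoint_family_onD[OF disj] that \<open>j < n\<close> \<open>s \<in> A j\<close> by blast
  qed (use that in auto)
  have zero: "g s = 0" if "\<And>j. j < n \<Longrightarrow> s \<notin> A j" for s
    unfolding g using that by (intro sum.neutral) auto
  show "finite_label M g 0"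
    unfolding finite_label_def
  proof (intro conjI allI impI)
    have "range g \<subseteq> insert 0 (c ` {..<n})" using eq zero by blast
    then show "finite (range g)" by (rule finite_subset) simp
    fix t :: 'b assume "t \<noteq> 0"
    then have "g -` {t} = (\<Union>i\<in>{i. i < n \<and> c i = t}. A i)"
      using eq zero by auto metis
    moreover have "\<dots> \<in> fmeasurable M"
      using A by (intro fmeasurable_finite_UN) auto
    ultimately show "g -` {t} \<in> fmeasurable M" by simp
  qed
next
  assume g: "finite_label M g 0"
  obtain e where e: "bij_betw e {0..<card (range g - {0})} (range g - {0})"
    using ex_bij_betw_nat_finite[OF finite_label_finite[OF g]] by blast
  define n where "n = card (range g - {0})"
  have bij: "bij_betw e {..<n} (range g - {0})"
    using e by (simp add: n_def atLeast0LessThan)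
  have "g -` {e i} \<in> fmeasurable M" if "i < n" for i
    using bij that by (intro finite_label_fibre[OF g]) (auto dest: bij_betwE)
  moreover have "disjoint_family_on (\<lambda>i. g -` {e i}) {..<n}"
    using bij by (auto simp: disjoint_family_on_def bij_betw_def inj_on_def)
  moreover have "g s = (\<Sum>i<n. indicator (g -` {e i}) s *\<^sub>R e i)" for s
    using finite_label_decompose[OF g, of "\<lambda>x. x" s]
      sum.reindex_bij_betw[OF bij, of "\<lambda>t. indicator (g -` {t}) s *\<^sub>R t"] by metis
  ultimately show "simple_vfun M g"
    unfolding simple_vfun_def by (intro exI[of _ n] exI[of _ "\<lambda>i. g -` {e i}"] exI[of _ e])
      (auto simp: fmeasurable_def)
qed

section \<open>Closure properties and measurability of simple and Bochner measurable
  functions\<close>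

lemma simple_vfun_map:
  "finite_label M T z \<Longrightarrow> h z = 0 \<Longrightarrow> simple_vfun M (\<lambda>s. h (T s))"
  unfolding simple_vfun_iff by (rule finite_label_map)

text \<open>The sum depends only on the pair of values, encoded as a tuple of length 2.\<close>

lemma simple_vfun_add:
  fixes f g :: "'s \<Rightarrow> 'x::real_normed_vector"
  assumes "simple_vfun M f" "simple_vfun M g"
  shows "simple_vfun M (f + g)"
proof -
  have "finite_label M (\<lambda>s i. if i < 2 then (if i = 0 then f else g) s else 0) (\<lambda>i::nat. 0)"
    using assms by (intro finite_label_tuple) (auto simp: simple_vfun_iff)
  from simple_vfun_map[OF this, of "\<lambda>t. t 0 + t 1"] show ?thesis
    by (simp add: plus_fun_def)
qed

lemma simple_vfun_scale: "simple_vfun M f \<Longrightarrow> simple_vfun M (a *\<^sub>R f)"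
  unfolding simple_vfun_iff scaleR_fun_def by (rule finite_label_map) auto

lemma simple_vfun_bochner_measurable: "simple_vfun M f \<Longrightarrow> bochner_measurable M f"
  unfolding bochner_measurable_def by (intro exI[of _ "\<lambda>_. f"]) auto

lemma bochner_measurable_add:
  assumes "bochner_measurable M f" "bochner_measurable M g"
  shows "bochner_measurable M (f + g)"
proof -
  obtain u v where "\<And>n. simple_vfun M (u n)" and u: "AE s in M. (\<lambda>n. u n s) \<longlonglongrightarrow> f s"
    and "\<And>n. simple_vfun M (v n)" and v: "AE s in M. (\<lambda>n. v n s) \<longlonglongrightarrow> g s"
    using assms unfolding bochner_measurable_def by blast
  then have "simple_vfun M (u n + v n)" for n by (intro simple_vfun_add)
  moreover have "AE s in M. (\<lambda>n. (u n + v n) s) \<longlonglongrightarrow> (f + g) s"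
    using u v by eventually_elim (auto intro: tendsto_add)
  ultimately show ?thesis
    unfolding bochner_measurable_def by (intro exI[of _ "\<lambda>n. u n + v n"]) auto
qed

lemma bochner_measurable_scale:
  assumes "bochner_measurable M f" shows "bochner_measurable M (a *\<^sub>R f)"
proof -
  obtain u where "\<And>n. simple_vfun M (u n)" and u: "AE s in M. (\<lambda>n. u n s) \<longlonglongrightarrow> f s"
    using assms unfolding bochner_measurable_def by blast
  then have "simple_vfun M (a *\<^sub>R u n)" for n by (intro simple_vfun_scale)
  moreover have "AE s in M. (\<lambda>n. (a *\<^sub>R u n) s) \<longlonglongrightarrow> (a *\<^sub>R f) s"
    using u by eventually_elim (auto simp: scaleR_fun_def intro: tendsto_scaleR)
  ultimately show ?thesis
    unfolding bochner_measurable_def by (intro exI[of _ "\<lambda>n. a *\<^sub>R u n"]) auto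
qed

lemma simple_vfun_norm_measurable:
  "simple_vfun M f \<Longrightarrow> (\<lambda>s. norm (f s)) \<in> borel_measurable M"
  unfolding simple_vfun_iff
  by (rule borel_measurable_simple_function, rule finite_label_simple_function,
      rule finite_label_map[where y = 0]) auto

text \<open>Completeness enters here: a set that agrees almost everywhere with a measurable one is
  itself measurable.\<close>

lemma (in complete_measure) borel_measurable_AE_eq:
  assumes "f \<in> borel_measurable M" "AE s in M. f s = g s"
  shows "g \<in> borel_measurable M"
proof (rule measurableI)
  fix B :: "'b set" assume "B \<in> sets borel"
  then have f: "f -` B \<inter> space M \<in> sets M" using assms(1) by (rule measurable_sets[rotated])
  have "AE s in M. s \<in> f -` B \<inter> space M \<longleftrightarrow> s \<in> g -` B \<inter> space M"
    using assms(2) by eventually_elim auto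
  then show "g -` B \<inter> space M \<in> sets M" using f by (rule in_sets_AE) auto
qed auto

text \<open>\<open>lim\<close> turns the approximating norms into a measurable function, whatever
  its values at points of divergence; it agrees with the norm of f almost everywhere.\<close>

lemma (in complete_measure) bochner_measurable_norm:
  assumes "bochner_measurable M f"
  shows "(\<lambda>s. norm (f s)) \<in> borel_measurable M"
proof -
  obtain u where u: "\<And>n. simple_vfun M (u n)" "AE s in M. (\<lambda>n. u n s) \<longlonglongrightarrow> f s"
    using assms unfolding bochner_measurable_def by blast
  have "(\<lambda>s. lim (\<lambda>n. norm (u n s))) \<in> borel_measurable M"
    by (rule borel_measurable_lim_metric[OF simple_vfun_norm_measurable[OF u(1)]])
  moreover have "AE s in M. lim (\<lambda>n. norm (u n s)) = norm (f s)"
    using u(2)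
  proof eventually_elim
    case (elim s)
    then show ?case by (intro limI tendsto_norm)
  qed
  ultimately show ?thesis by (rule borel_measurable_AE_eq)
qed

section \<open>Diameter two properties of Koethe--Bochner spaces\<close>

lemma sum_fun_eval: "(\<Sum>i\<in>I. f i) s = (\<Sum>i\<in>I. f i s)"
  by (induction I rule: infinite_finite_induct) auto

lemma simple_vfun_indicator:
  assumes "A \<in> fmeasurable M" shows "simple_vfun M (\<lambda>s. indicator A s *\<^sub>R c)"
proof -
  have "finite_label M (\<lambda>s. s \<in> A) False"
    using assms by (auto simp: finite_label_def vimage_def)
  from simple_vfun_map[OF this, of "\<lambda>b. if b then c else 0"]
  have "simple_vfun M (\<lambda>s. if s \<in> A then c else 0)" by simp
  moreover have "(\<lambda>s. indicator A s *\<^sub>R c) = (\<lambda>s. if s \<in> A then c else 0)" by auto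
  ultimately show ?thesis by simp
qed

text \<open>Isolates the order and seminorm structure of \<open>kothe_space\<close>, so that
  \<open>Lp_real\<close> qualifies as soon as Minkowski's inequality is known.\<close>

locale kothe_seminorm = complete_measure M + E: seminormed_subspace E NE
  for M :: "'s measure" and E :: "('s \<Rightarrow> real) set" and NE +
  assumes E_measurable: "f \<in> E \<Longrightarrow> f \<in> borel_measurable M"
    and null_imp_AE: "f \<in> E \<Longrightarrow> NE f = 0 \<Longrightarrow> AE s in M. f s = 0"
    and indicator_mem: "A \<in> fmeasurable M \<Longrightarrow> indicator A \<in> E"
    and solid_mem: "f \<in> E \<Longrightarrow> g \<in> borel_measurable M \<Longrightarrow> AE s in M. \<bar>g s\<bar> \<le> \<bar>f s\<bar> \<Longrightarrow> g \<in> E"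
    and solid_le: "f \<in> E \<Longrightarrow> g \<in> borel_measurable M \<Longrightarrow> AE s in M. \<bar>g s\<bar> \<le> \<bar>f s\<bar> \<Longrightarrow> NE g \<le> NE f"
begin

lemma indicator_norm_pos:
  assumes "A \<in> fmeasurable M" "emeasure M A \<noteq> 0"
  shows "NE (indicator A) > 0"
proof (rule ccontr)
  assume "\<not> NE (indicator A) > 0"
  then have "NE (indicator A) = 0"
    using E.seminorm_nonneg[OF indicator_mem[OF assms(1)]] by simp
  then have "AE s in M. indicator A s = (0::real)"
    using null_imp_AE[OF indicator_mem[OF assms(1)]] by simp
  then have "AE s in M. s \<notin> A" by eventually_elim (auto simp: indicator_eq_0_iff)
  then have "A \<in> null_sets M"
    using assms(1) by (auto simp: null_sets_iff_AE dest: fmeasurableD sets.sets_into_space)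
  then show False using assms(2) by auto
qed

lemma kothe_bochner_memI:
  assumes "bochner_measurable M f" "g \<in> E" "\<And>s. norm (f s) \<le> \<bar>g s\<bar>"
  shows "f \<in> kothe_bochner M E" and "kothe_bochner_norm NE f \<le> NE g"
  using solid_mem[OF assms(2) bochner_measurable_norm[OF assms(1)]]
    solid_le[OF assms(2) bochner_measurable_norm[OF assms(1)]] assms
  by (auto simp: kothe_bochner_def kothe_bochner_norm_def)

lemma kothe_bochner_seminormed:
  "seminormed_subspace (kothe_bochner M E :: ('s \<Rightarrow> 'x::real_normed_vector) set) (kothe_bochner_norm NE)"
proof
  have "bochner_measurable M (0 :: 's \<Rightarrow> 'x)"
    using simple_vfun_bochner_measurable[OF simple_vfun_indicator[of "{}" M 0]]
    by (simp add: zero_fun_def)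
  then show "(0 :: 's \<Rightarrow> 'x) \<in> kothe_bochner M E"
    using kothe_bochner_memI(1) E.zero_mem by fastforce
  fix f g :: "'s \<Rightarrow> 'x" and a :: real
  assume f: "f \<in> kothe_bochner M E"
  have sc: "(\<lambda>s. norm ((a *\<^sub>R f) s)) = \<bar>a\<bar> *\<^sub>R (\<lambda>s. norm (f s))"
    by (simp add: scaleR_fun_def)
  show "a *\<^sub>R f \<in> kothe_bochner M E"
    using f E.scale_mem bochner_measurable_scale by (auto simp: kothe_bochner_def sc)
  show "kothe_bochner_norm NE (a *\<^sub>R f) = \<bar>a\<bar> * kothe_bochner_norm NE f"
    using f E.homogeneous[of "\<lambda>s. norm (f s)" "\<bar>a\<bar>"]
    by (simp add: kothe_bochner_norm_def kothe_bochner_def sc)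
  assume g: "g \<in> kothe_bochner M E"
  let ?k = "(\<lambda>s. norm (f s)) + (\<lambda>s. norm (g s))"
  have k: "bochner_measurable M (f + g)" "?k \<in> E" "\<And>s. norm ((f + g) s) \<le> \<bar>?k s\<bar>"
    using f g by (auto simp: kothe_bochner_def bochner_measurable_add E.add_mem
        intro: order_trans[OF norm_triangle_ineq])
  show "f + g \<in> kothe_bochner M E" by (rule kothe_bochner_memI(1)[OF k])
  have "kothe_bochner_norm NE (f + g) \<le> NE ?k" by (rule kothe_bochner_memI(2)[OF k])
  also have "\<dots> \<le> kothe_bochner_norm NE f + kothe_bochner_norm NE g"
    using f g E.triangle by (auto simp: kothe_bochner_def kothe_bochner_norm_def)
  finally show "kothe_bochner_norm NE (f + g) \<le> kothe_bochner_norm NE f + kothe_bochner_norm NE g" .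
qed

end

text \<open>V and N are parameters tied by equations, so that both \<open>kothe_bochner M E\<close>
  and the separately defined \<open>Lp_bochner M p\<close> are instances.\<close>

locale kothe_bochner_dense = kothe_seminorm M E NE
  for M :: "'s measure" and E NE and V :: "('s \<Rightarrow> 'x::real_normed_vector) set" and N +
  assumes V_eq: "V = kothe_bochner M E"
    and N_eq: "N = kothe_bochner_norm NE"
    and dense: "simple_dense M N V"
begin

sublocale seminormed_subspace V N
  unfolding V_eq N_eq by (rule kothe_bochner_seminormed)

lemma norm_mono:
  assumes "f \<in> V" "g \<in> V" "\<And>s. norm (g s) \<le> norm (f s)"
  shows "N g \<le> N f"
  using assms kothe_bochner_memI(2)[of g "\<lambda>s. norm (f s)"]
  by (auto simp: V_eq N_eq kothe_bochner_def kothe_bochner_norm_def)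

lemma label_mem:
  assumes "finite_label M T z" "h z = 0"
  shows "(\<lambda>s. h (T s)) \<in> V"
  unfolding V_eq
proof (rule kothe_bochner_memI(1))
  let ?R = "range T - {z}"
  show "bochner_measurable M (\<lambda>s. h (T s))"
    by (intro simple_vfun_bochner_measurable simple_vfun_map[where h = h, OF assms])
  show "(\<Sum>t\<in>?R. norm (h t) *\<^sub>R indicator (T -` {t})) \<in> E"
    using finite_label_fibre[OF assms(1)] by (intro E.sum_mem E.scale_mem indicator_mem) auto
  fix s
  have "norm (h (T s)) = (\<Sum>t\<in>?R. norm (h t) *\<^sub>R indicator (T -` {t})) s"
    using finite_label_decompose[OF assms(1), of "\<lambda>t. norm (h t)" s] assms(2)
    by (simp only: sum_fun_eval scaleR_fun_def) (simp add: mult.commute)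
  then show "norm (h (T s)) \<le> \<bar>(\<Sum>t\<in>?R. norm (h t) *\<^sub>R indicator (T -` {t})) s\<bar>" by simp
qed

lemma simple_mem: "simple_vfun M g \<Longrightarrow> g \<in> V"
  unfolding simple_vfun_iff using label_mem[of g 0 "\<lambda>x. x"] by simp

lemma indicator_scale_mem: "A \<in> fmeasurable M \<Longrightarrow> (\<lambda>s. indicator A s *\<^sub>R c) \<in> V"
  by (intro simple_mem simple_vfun_indicator)

lemma norm_indicator_scale:
  assumes "A \<in> fmeasurable M"
  shows "N (\<lambda>s. indicator A s *\<^sub>R c) = norm c * NE (indicator A)"
proof -
  have "(\<lambda>s. norm (indicator A s *\<^sub>R c)) = norm c *\<^sub>R indicator A"
    by (auto simp: scaleR_fun_def indicator_def)
  then show ?thesis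
    using E.homogeneous[OF indicator_mem[OF assms], of "norm c"] by (simp add: N_eq kothe_bochner_norm_def)
qed

lemma fibre_functional:
  assumes "dual_fun V N \<phi>" "A \<in> fmeasurable M"
  shows "dual_fun UNIV norm (\<lambda>c. \<phi> (\<lambda>s. indicator A s *\<^sub>R c))"
  unfolding dual_fun_def
proof (intro conjI ballI allI)
  fix u v :: 'x and a b :: real
  have "(\<lambda>s. indicator A s *\<^sub>R (a *\<^sub>R u + b *\<^sub>R v))
      = a *\<^sub>R (\<lambda>s. indicator A s *\<^sub>R u) + b *\<^sub>R (\<lambda>s. indicator A s *\<^sub>R v)"
    by (auto simp: scaleR_fun_def indicator_def)
  then show "\<phi> (\<lambda>s. indicator A s *\<^sub>R (a *\<^sub>R u + b *\<^sub>R v))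
      = a * \<phi> (\<lambda>s. indicator A s *\<^sub>R u) + b * \<phi> (\<lambda>s. indicator A s *\<^sub>R v)"
    using assms(1) indicator_scale_mem[OF assms(2)] unfolding dual_fun_def by metis
next
  obtain C where "C > 0" and C: "\<And>v. v \<in> V \<Longrightarrow> \<bar>\<phi> v\<bar> \<le> C * N v"
    using dual_fun_bounded[OF assms(1)] by blast
  have "\<bar>\<phi> (\<lambda>s. indicator A s *\<^sub>R c)\<bar> \<le> C * NE (indicator A) * norm c" for c
    using C[OF indicator_scale_mem[OF assms(2)], of c] norm_indicator_scale[OF assms(2), of c]
    by (simp add: algebra_simps)
  then show "\<exists>C. \<forall>v\<in>UNIV. \<bar>\<phi> (\<lambda>s. indicator A s *\<^sub>R v)\<bar> \<le> C * norm v" by blast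
qed

lemma dual_fun_label:
  assumes "dual_fun V N \<phi>" "finite_label M T z" "h z = 0"
  shows "\<phi> (\<lambda>s. h (T s)) = (\<Sum>t\<in>range T - {z}. \<phi> (\<lambda>s. indicator (T -` {t}) s *\<^sub>R h t))"
proof -
  have "(\<lambda>s. h (T s)) = (\<Sum>t\<in>range T - {z}. (\<lambda>s. indicator (T -` {t}) s *\<^sub>R h t))"
    by (rule ext) (simp only: sum_fun_eval finite_label_decompose[where h = h, OF assms(2,3)])
  then show ?thesis
    using dual_fun_sum[OF assms(1), of "range T - {z}" "\<lambda>t s. indicator (T -` {t}) s *\<^sub>R h t"]
      indicator_scale_mem finite_label_fibre[OF assms(2)] by auto
qed

text \<open>Provides the nonzero functional needed where a fibre functional vanishes, without Hahn--Banach.\<close>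
lemma nonzero_fibre_functional:
  assumes "dual_fun V N \<phi>" "finite_label M T z" "h z = 0" "\<phi> (\<lambda>s. h (T s)) \<noteq> 0"
  obtains \<psi> and x :: 'x where "dual_fun UNIV norm \<psi>" "\<psi> x \<noteq> 0"
proof -
  obtain t where t: "t \<in> range T - {z}" "\<phi> (\<lambda>s. indicator (T -` {t}) s *\<^sub>R h t) \<noteq> 0"
    using assms(4) unfolding dual_fun_label[where h = h, OF assms(1-3)] by (meson sum.not_neutral_contains_not_neutral)
  then show ?thesis
    using that[OF fibre_functional[OF assms(1) finite_label_fibre[OF assms(2)]]] by blast
qed

text \<open>A simple approximant of f may leave the unit ball. Hence f is first shrunk by
  \<open>1 - \<eta>\<close> and then approximated within \<open>\<eta>\<close>; both moves together
  cost less than \<open>2 * \<eta> \<le> \<kappa>\<close>.\<close>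

lemma simple_approx:
  assumes "f \<in> V" "N f \<le> 1" "\<kappa> > 0"
  obtains g where "simple_vfun M g" "N g \<le> 1" "N (f - g) < \<kappa>"
proof -
  define \<eta> where "\<eta> = min 1 (\<kappa> / 2)"
  have \<eta>: "\<eta> > 0" "\<eta> \<le> 1" "2 * \<eta> \<le> \<kappa>" using assms(3) by (auto simp: \<eta>_def)
  obtain g where g: "g \<in> V" "simple_vfun M g" "N ((1 - \<eta>) *\<^sub>R f - g) < \<eta>"
    using dense scale_mem[OF assms(1), of "1 - \<eta>"] \<eta>(1) unfolding simple_dense_def by blast
  let ?f = "(1 - \<eta>) *\<^sub>R f"
  have V: "?f \<in> V" using assms(1) by (rule scale_mem)
  have "N ?f \<le> 1 - \<eta>"
    using \<eta> mult_left_mono[OF assms(2), of "1 - \<eta>"] homogeneous[OF assms(1), of "1 - \<eta>"] by simp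
  then have "N g \<le> 1"
    using seminorm_le_add_diff[OF g(1) V] seminorm_diff_commute[OF g(1) V] g(3) by simp
  moreover have "N (f - g) < \<kappa>"
  proof -
    have "f - ?f = \<eta> *\<^sub>R f" by (simp add: algebra_simps)
    then have "N (f - ?f) \<le> \<eta>"
      using homogeneous[OF assms(1), of \<eta>] mult_left_mono[OF assms(2), of \<eta>] \<eta>(1) by simp
    moreover have "N (f - g) \<le> N (f - ?f) + N (?f - g)"
      using triangle[OF diff_mem[OF assms(1) V] diff_mem[OF V g(1)]] by simp
    ultimately show ?thesis using g(3) \<eta>(3) by linarith
  qed
  ultimately show ?thesis using that g(2) by blast
qed

text \<open>A functional of norm one is dominated by N. So passing from f to g loses less than
  \<open>\<eta> / 2\<close>, and the large value at g makes \<open>N g\<close> large as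
  well.\<close>

lemma simple_in_slice:
  assumes "dual_fun V N \<phi>" "dual_norm V N \<phi> = 1" "\<eta> > 0"
  obtains g where "simple_vfun M g" "N g \<le> 1" "\<phi> g > 1 - \<eta>" "N g > 1 - \<eta>"
proof -
  have le: "\<phi> v \<le> N v" if "v \<in> V" for v
    using dual_fun_le_dual_norm[OF assms(1) that] assms(2) by simp
  obtain f where f: "f \<in> unit_ball V N" "1 - \<eta> / 2 < \<phi> f"
    using dual_norm_approx[of "1 - \<eta> / 2" \<phi>] assms(2,3) by auto
  then have fV: "f \<in> V" "N f \<le> 1" by (auto simp: unit_ball_def)
  obtain g where g: "simple_vfun M g" "N g \<le> 1" "N (f - g) < \<eta> / 2"
    using simple_approx[OF fV, of "\<eta> / 2"] assms(3) by auto
  have gV: "g \<in> V" by (rule simple_mem[OF g(1)])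
  have "\<phi> g > 1 - \<eta>"
    using le[OF diff_mem[OF fV(1) gV]] dual_fun_diff[OF assms(1) fV(1) gV] g(3) f(2) by linarith
  then show ?thesis using that[OF g(1,2)] le[OF gV] by simp
qed

text \<open>The difference dominates \<open>b *\<^sub>R g\<close> pointwise, so solidity applies.
  Vanishing of u and v at 0 keeps both functions supported on a set of finite measure.\<close>

lemma norm_diff_label:
  assumes "simple_vfun M g" "0 \<le> b" "\<And>t. norm (u t - v t) \<ge> b * norm t" "u 0 = 0" "v 0 = 0"
  shows "N ((\<lambda>s. u (g s)) - (\<lambda>s. v (g s))) \<ge> b * N g"
proof -
  have g: "finite_label M g 0" "g \<in> V" using assms(1) simple_mem by (auto simp: simple_vfun_iff)
  have "N (b *\<^sub>R g) \<le> N ((\<lambda>s. u (g s)) - (\<lambda>s. v (g s)))"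
    using assms g by (intro norm_mono diff_mem label_mem[OF g(1)] scale_mem) (auto simp: scaleR_fun_def)
  then show ?thesis using assms(2) homogeneous[OF g(2), of b] by simp
qed

theorem LD2P_kothe_bochner:
  assumes X: "LD2P (UNIV :: 'x set) norm"
  shows "LD2P V N"
  unfolding LD2P_def
proof (intro allI impI)
  fix \<phi> \<alpha> assume "dual_fun V N \<phi> \<and> dual_norm V N \<phi> = 1 \<and> (\<alpha>::real) > 0"
  then have \<phi>: "dual_fun V N \<phi>" "dual_norm V N \<phi> = 1" and \<alpha>: "\<alpha> > 0" by auto
  show "set_diam N (slice V N \<phi> \<alpha>) = 2"
  proof (rule set_diam_eq_2I)
    show "slice V N \<phi> \<alpha> \<subseteq> unit_ball V N" by (auto simp: slice_def)
    fix \<epsilon> :: real assume "\<epsilon> > 0"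
    \<comment> \<open>The bound by \<open>\<alpha>\<close> keeps the new functions in the slice, the
      bound by 1 keeps \<open>2 - \<eta>\<close> positive, and \<open>\<epsilon> / 4\<close> covers
      the loss in the product \<open>(2 - \<eta>) * (1 - \<eta> / 2)\<close>.\<close>
    define \<eta> where "\<eta> = min (min \<alpha> 1) (\<epsilon> / 4)"
    have \<eta>: "\<eta> > 0" "\<eta> \<le> \<alpha>" "\<eta> \<le> 1" "4 * \<eta> \<le> \<epsilon>"
      using \<alpha> \<open>\<epsilon> > 0\<close> by (auto simp: \<eta>_def)
    obtain g where g: "simple_vfun M g" "N g \<le> 1" and \<phi>g: "\<phi> g > 1 - \<eta> / 2" and Ng: "N g > 1 - \<eta> / 2"
      using simple_in_slice[OF \<phi>, of "\<eta> / 2"] \<eta>(1) by auto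
    have gV: "g \<in> V" and gl: "finite_label M g 0"
      using g(1) simple_mem by (auto simp: simple_vfun_iff)
    define R where "R = range g - {0}"
    define \<psi> where "\<psi> t c = \<phi> (\<lambda>s. indicator (g -` {t}) s *\<^sub>R c)" for t c
    have \<psi>: "dual_fun UNIV norm (\<psi> t)" if "t \<noteq> 0" for t
      unfolding \<psi>_def using finite_label_fibre[OF gl that] by (rule fibre_functional[OF \<phi>(1)])
    have decomp: "\<phi> (\<lambda>s. h (g s)) = (\<Sum>t\<in>R. \<psi> t (h t))" if "h 0 = 0" for h
      unfolding \<psi>_def R_def by (rule dual_fun_label[where h = h, OF \<phi>(1) gl that])
    obtain \<psi>0 and x0 :: 'x where \<psi>0: "dual_fun UNIV norm \<psi>0" "\<psi>0 x0 \<noteq> 0"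
      using nonzero_fibre_functional[OF \<phi>(1) gl, of "\<lambda>x. x"] \<phi>g \<eta> by auto
    \<comment> \<open>Half of \<open>\<eta>\<close> was spent on g; the other half is shared among
      the pieces. The summand 1 avoids division by 0.\<close>
    define \<delta> where "\<delta> = \<eta> / (2 * (real (card R) + 1))"
    have \<delta>: "\<delta> > 0" using \<eta>(1) by (simp add: \<delta>_def)
    have card: "real (card R) * \<delta> \<le> \<eta> / 2"
      using \<eta>(1) by (simp add: \<delta>_def field_simps)
    \<comment> \<open>Stated for all t, so that the choice gives total functions. At
      \<open>t = 0\<close> the norm bounds force the value 0, and no functional is considered
      because that fibre may have infinite measure.\<close>
    have "\<exists>u v. norm u \<le> norm t \<and> norm v \<le> norm t \<and>
        (t \<noteq> 0 \<longrightarrow> \<psi> t u > \<psi> t t - \<delta> \<and> \<psi> t v > \<psi> t t - \<delta>) \<and> norm (u - v) \<ge> (2 - \<eta>) * norm t" for t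
    proof (cases "t = 0")
      case False
      then show ?thesis using LD2P_move[OF X \<psi>[OF False] \<psi>0 \<delta> \<eta>(1), of t] by blast
    qed (auto intro!: exI[of _ 0])
    then obtain u v where uv: "\<And>t. norm (u t) \<le> norm t" "\<And>t. norm (v t) \<le> norm t"
      "\<And>t. t \<noteq> 0 \<Longrightarrow> \<psi> t (u t) > \<psi> t t - \<delta>" "\<And>t. t \<noteq> 0 \<Longrightarrow> \<psi> t (v t) > \<psi> t t - \<delta>"
      "\<And>t. norm (u t - v t) \<ge> (2 - \<eta>) * norm t"
      by metis
    have slice: "(\<lambda>s. w (g s)) \<in> slice V N \<phi> \<alpha>"
      if w: "\<And>t. norm (w t) \<le> norm t" "\<And>t. t \<noteq> 0 \<Longrightarrow> \<psi> t (w t) > \<psi> t t - \<delta>" for w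
    proof -
      have w0: "w 0 = 0" using w(1)[of 0] by simp
      have "(\<Sum>t\<in>R. \<psi> t t - \<delta>) \<le> (\<Sum>t\<in>R. \<psi> t (w t))"
        using w(2) by (intro sum_mono less_imp_le) (auto simp: R_def)
      then have "\<phi> g - real (card R) * \<delta> \<le> \<phi> (\<lambda>s. w (g s))"
        using decomp[of "\<lambda>x. x"] decomp[of w, OF w0] by (simp add: sum_subtractf)
      then have "\<phi> (\<lambda>s. w (g s)) > 1 - \<alpha>" using \<phi>g card \<eta>(2) by linarith
      moreover have wV: "(\<lambda>s. w (g s)) \<in> V" by (rule label_mem[where h = w, OF gl w0])
      moreover have "N (\<lambda>s. w (g s)) \<le> 1"
        using norm_mono[OF gV wV w(1)] g(2) by linarith
      ultimately show ?thesis by (simp add: slice_def unit_ball_def)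
    qed
    have "N ((\<lambda>s. u (g s)) - (\<lambda>s. v (g s))) \<ge> (2 - \<eta>) * N g"
      using \<eta>(3) uv(1)[of 0] uv(2)[of 0] by (intro norm_diff_label g(1) uv(5)) auto
    moreover have "(2 - \<eta>) * N g \<ge> (2 - \<eta>) * (1 - \<eta> / 2)"
      using Ng \<eta>(3) by (intro mult_left_mono) auto
    moreover have "(2 - \<eta>) * (1 - \<eta> / 2) = 2 - 2 * \<eta> + \<eta> * \<eta> / 2" by (simp add: field_simps)
    moreover have "\<eta> * \<eta> > 0" using \<eta>(1) by simp
    ultimately have "N ((\<lambda>s. u (g s)) - (\<lambda>s. v (g s))) > 2 - \<epsilon>" using \<eta>(1,4) by linarith
    then show "\<exists>y\<in>slice V N \<phi> \<alpha>. \<exists>z\<in>slice V N \<phi> \<alpha>. N (y - z) > 2 - \<epsilon>"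
      using slice[of u] slice[of v] uv by blast
  qed
qed

section \<open>The diameter two property: finitely many functionals and the unit sphere\<close>

lemma dual_funs_bounded:
  assumes "finite F" "\<And>\<phi>. \<phi> \<in> F \<Longrightarrow> dual_fun V N \<phi>"
  obtains C where "C > 0" "\<And>\<phi> v. \<phi> \<in> F \<Longrightarrow> v \<in> V \<Longrightarrow> \<bar>\<phi> v\<bar> \<le> C * N v"
proof -
  have "\<forall>\<phi>\<in>F. \<exists>C>0. \<forall>v\<in>V. \<bar>\<phi> v\<bar> \<le> C * N v"
    using dual_fun_bounded assms(2) by metis
  then obtain C where C: "\<And>\<phi>. \<phi> \<in> F \<Longrightarrow> C \<phi> > 0" "\<And>\<phi> v. \<phi> \<in> F \<Longrightarrow> v \<in> V \<Longrightarrow> \<bar>\<phi> v\<bar> \<le> C \<phi> * N v"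
    unfolding bchoice_iff by blast
  have nonneg: "sum C F \<ge> 0" using C(1) by (intro sum_nonneg less_imp_le) auto
  \<comment> \<open>The summand 1 makes the common constant positive even if F is empty.\<close>
  have "\<bar>\<phi> v\<bar> \<le> (1 + sum C F) * N v" if "\<phi> \<in> F" "v \<in> V" for \<phi> v
  proof -
    have "C \<phi> \<le> sum C F"
      using assms(1) that(1) C(1) by (intro member_le_sum) (auto intro: less_imp_le)
    then have "C \<phi> * N v \<le> (1 + sum C F) * N v"
      using seminorm_nonneg[OF that(2)] by (intro mult_right_mono) auto
    then show ?thesis using C(2)[OF that] by linarith
  qed
  then show ?thesis using that[of "1 + sum C F"] nonneg by auto
qed

text \<open>Moving along a large vector on which the functionals almost vanish, one reaches the unit
  sphere without leaving a given weak neighbourhood.\<close>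
lemma weak_neighbourhood_meets_sphere:
  assumes X: "D2P (UNIV :: 'x set) norm"
    and A: "A \<in> fmeasurable M" "emeasure M A \<noteq> 0"
    and F: "finite F" "\<And>\<phi>. \<phi> \<in> F \<Longrightarrow> dual_fun V N \<phi>"
    and f: "f \<in> V" "N f \<le> 1" and "\<epsilon> > 0"
  obtains h where "h \<in> V" "N h = 1" "\<And>\<phi>. \<phi> \<in> F \<Longrightarrow> \<bar>\<phi> h - \<phi> f\<bar> < \<epsilon>"
proof -
  define k where "k = NE (indicator A)"
  have k: "k > 0" unfolding k_def by (rule indicator_norm_pos[OF A])
  \<comment> \<open>The parameter below runs up to \<open>2 / k\<close>, so a functional smaller
    than \<open>\<epsilon> * k / 4\<close> in absolute value at e changes by at most
    \<open>\<epsilon> / 2\<close>.\<close>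
  have pos: "\<epsilon> * k / 4 > 0" using k \<open>\<epsilon> > 0\<close> by simp
  obtain x :: 'x where x: "norm x \<ge> 1"
    "\<And>\<phi>. \<phi> \<in> F \<Longrightarrow> \<bar>\<phi> (\<lambda>s. indicator A s *\<^sub>R x)\<bar> < \<epsilon> * k / 4"
    by (rule D2P_large_near_kernel[OF X F(1) fibre_functional[OF F(2) A(1)] pos])
      (assumption, rule that)
  define e where "e = (\<lambda>s. indicator A s *\<^sub>R x)"
  have eV: "e \<in> V" unfolding e_def by (rule indicator_scale_mem[OF A(1)])
  have Ne: "N e \<ge> k"
    unfolding e_def norm_indicator_scale[OF A(1)] k_def[symmetric] using x(1) k by simp
  have te: "f + t *\<^sub>R e \<in> V" for t using f(1) eV by (intro add_mem scale_mem)
  \<comment> \<open>Along the segment the norm is continuous, starts at \<open>N f \<le> 1\<close>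
    and ends at \<open>2 - N f\<close> or more, hence at 1 or more; the intermediate value theorem
    then finds the sphere.\<close>
  have "continuous_on {0..2 / k} (\<lambda>t. N (f + t *\<^sub>R e))"
  proof (rule lipschitz_on_continuous_on[where L = "N e"], rule lipschitz_onI)
    fix t t' :: real
    have eq: "(f + t *\<^sub>R e) - (f + t' *\<^sub>R e) = (t - t') *\<^sub>R e" by (simp add: algebra_simps)
    have "\<bar>N (f + t *\<^sub>R e) - N (f + t' *\<^sub>R e)\<bar> \<le> N ((f + t *\<^sub>R e) - (f + t' *\<^sub>R e))"
      using seminorm_le_add_diff[OF te te, of t t'] seminorm_le_add_diff[OF te te, of t' t]
        seminorm_diff_commute[OF te te, of t t'] by linarith
    also have "\<dots> = \<bar>t - t'\<bar> * N e" unfolding eq by (rule homogeneous[OF eV])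
    finally show "dist (N (f + t *\<^sub>R e)) (N (f + t' *\<^sub>R e)) \<le> N e * dist t t'"
      by (simp add: dist_real_def mult.commute)
  qed (rule seminorm_nonneg[OF eV])
  moreover have "N (f + (2 / k) *\<^sub>R e) \<ge> 1"
  proof -
    have "2 \<le> 2 / k * N e" using Ne k by (simp add: field_simps)
    also have "\<dots> = N ((2 / k) *\<^sub>R e)" using homogeneous[OF eV, of "2 / k"] k by simp
    also have "\<dots> \<le> N (f + (2 / k) *\<^sub>R e) + N f"
      using triangle_diff[OF te f(1), of "2 / k"] by simp
    finally show ?thesis using f(2) by simp
  qed
  ultimately obtain t where t: "0 \<le> t" "t \<le> 2 / k" "N (f + t *\<^sub>R e) = 1"
    using IVT'[of "\<lambda>t. N (f + t *\<^sub>R e)" 0 1 "2 / k"] f(2) k by auto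
  have "\<bar>\<phi> (f + t *\<^sub>R e) - \<phi> f\<bar> < \<epsilon>" if "\<phi> \<in> F" for \<phi>
  proof -
    have "\<phi> (f + t *\<^sub>R e) - \<phi> f = t * \<phi> e"
      using dual_fun_add[OF F(2)[OF that] f(1) scale_mem[OF eV]] dual_fun_scale[OF F(2)[OF that] eV] by simp
    then have "\<bar>\<phi> (f + t *\<^sub>R e) - \<phi> f\<bar> = t * \<bar>\<phi> e\<bar>" using t(1) by (simp add: abs_mult)
    also have "\<dots> \<le> (2 / k) * (\<epsilon> * k / 4)"
      using t x(2)[OF that] k by (intro mult_mono) (auto simp: e_def)
    also have "\<dots> < \<epsilon>" using k \<open>\<epsilon> > 0\<close> by simp
    finally show ?thesis .
  qed
  then show ?thesis using that te t(3) by blast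
qed

text \<open>The set A excludes the degenerate case that N vanishes on V, where no set has diameter
  2; it also carries the large vector that leads to the sphere.\<close>

theorem D2P_kothe_bochner:
  assumes X: "D2P (UNIV :: 'x set) norm"
    and A: "A \<in> fmeasurable M" "emeasure M A \<noteq> 0"
  shows "D2P V N"
  unfolding D2P_def
proof (intro allI impI)
  fix W assume W: "rel_weakly_open V N W \<and> W \<noteq> {}"
  then have sub: "W \<subseteq> unit_ball V N" by (simp add: rel_weakly_open_def)
  obtain f where "f \<in> W" using W by blast
  then have f: "f \<in> V" "N f \<le> 1" using sub by (auto simp: unit_ball_def)
  have "\<exists>F \<epsilon>. finite F \<and> (\<forall>\<phi>\<in>F. dual_fun V N \<phi>) \<and> \<epsilon> > 0 \<and>
      {y \<in> unit_ball V N. \<forall>\<phi>\<in>F. \<bar>\<phi> y - \<phi> f\<bar> < \<epsilon>} \<subseteq> W"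
    using W \<open>f \<in> W\<close> by (simp add: rel_weakly_open_def)
  then obtain F \<epsilon>0 where F: "finite F" "\<And>\<phi>. \<phi> \<in> F \<Longrightarrow> dual_fun V N \<phi>" "\<epsilon>0 > 0"
    and FW: "{y \<in> unit_ball V N. \<forall>\<phi>\<in>F. \<bar>\<phi> y - \<phi> f\<bar> < \<epsilon>0} \<subseteq> W"
    by (elim exE conjE) blast
  \<comment> \<open>Error budget for each functional in F: \<open>\<epsilon>0 / 3\<close> from f to
    h, \<open>\<epsilon>0 / 3\<close> from h to the simple g, and \<open>\<epsilon>0 / 4\<close>
    from g to the modified functions.\<close>
  obtain h where h: "h \<in> V" "N h = 1" "\<And>\<phi>. \<phi> \<in> F \<Longrightarrow> \<bar>\<phi> h - \<phi> f\<bar> < \<epsilon>0 / 3"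
    using weak_neighbourhood_meets_sphere[OF X A F(1,2) f, of "\<epsilon>0 / 3"] F(3) by auto
  obtain C where C: "C > 0" "\<And>\<phi> v. \<phi> \<in> F \<Longrightarrow> v \<in> V \<Longrightarrow> \<bar>\<phi> v\<bar> \<le> C * N v"
    using dual_funs_bounded[OF F(1,2)] by blast
  show "set_diam N W = 2"
  proof (rule set_diam_eq_2I[OF sub])
    fix \<epsilon> :: real assume "\<epsilon> > 0"
    define \<eta> where "\<eta> = min 1 (\<epsilon> / 4)"
    have \<eta>: "\<eta> > 0" "\<eta> \<le> 1" "4 * \<eta> \<le> \<epsilon>"
      using \<open>\<epsilon> > 0\<close> by (auto simp: \<eta>_def)
    \<comment> \<open>The bound by \<open>\<eta>\<close> keeps \<open>N g\<close> above
      \<open>1 - \<eta>\<close>; the other one turns distance into an error of at most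
      \<open>\<epsilon>0 / 3\<close> in every functional, by the common bound C.\<close>
    define \<kappa> where "\<kappa> = min \<eta> (\<epsilon>0 / (3 * C))"
    have \<kappa>: "\<kappa> > 0" "\<kappa> \<le> \<eta>" "C * \<kappa> \<le> \<epsilon>0 / 3"
      using \<eta>(1) F(3) C(1) by (auto simp: \<kappa>_def min_def field_simps)
    obtain g where g: "simple_vfun M g" "N g \<le> 1" "N (h - g) < \<kappa>"
      using simple_approx[of h \<kappa>] h \<kappa>(1) by auto
    have gV: "g \<in> V" and gl: "finite_label M g 0"
      using g(1) simple_mem by (auto simp: simple_vfun_iff)
    have Ng: "N g > 1 - \<eta>"
      using seminorm_le_add_diff[OF h(1) gV] h(2) g(3) \<kappa>(2) by linarith
    have \<phi>g: "\<bar>\<phi> g - \<phi> f\<bar> < 2 * \<epsilon>0 / 3" if "\<phi> \<in> F" for \<phi>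
    proof -
      have "\<bar>\<phi> (h - g)\<bar> \<le> C * N (h - g)" using C(2)[OF that diff_mem[OF h(1) gV]] .
      also have "\<dots> \<le> C * \<kappa>" using C(1) g(3) by simp
      finally have "\<bar>\<phi> h - \<phi> g\<bar> \<le> \<epsilon>0 / 3"
        using dual_fun_diff[OF F(2)[OF that] h(1) gV] \<kappa>(3) by simp
      then show ?thesis using h(3)[OF that] by linarith
    qed
    define R where "R = range g - {0}"
    define \<psi> where "\<psi> t \<phi> c = \<phi> (\<lambda>s. indicator (g -` {t}) s *\<^sub>R c)" for t and \<phi> :: "('s \<Rightarrow> 'x) \<Rightarrow> real" and c
    have \<psi>: "dual_fun UNIV norm (\<psi> t \<phi>)" if "t \<noteq> 0" "\<phi> \<in> F" for t \<phi>
      unfolding \<psi>_def using finite_label_fibre[OF gl that(1)] by (rule fibre_functional[OF F(2)[OF that(2)]])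
    have decomp: "\<phi> (\<lambda>s. h (g s)) = (\<Sum>t\<in>R. \<psi> t \<phi> (h t))" if "\<phi> \<in> F" "h 0 = 0" for h \<phi>
      unfolding \<psi>_def R_def by (rule dual_fun_label[where h = h, OF F(2)[OF that(1)] gl that(2)])
    define \<delta> where "\<delta> = \<epsilon>0 / (4 * (real (card R) + 1))"
    have \<delta>: "\<delta> > 0" using F(3) by (simp add: \<delta>_def)
    have card: "real (card R) * \<delta> \<le> \<epsilon>0 / 4"
      using F(3) by (simp add: \<delta>_def field_simps)
    have "\<exists>u v. norm u \<le> norm t \<and> norm v \<le> norm t \<and>
        (t \<noteq> 0 \<longrightarrow> (\<forall>\<phi>\<in>F. \<bar>\<psi> t \<phi> u - \<psi> t \<phi> t\<bar> < \<delta> \<and> \<bar>\<psi> t \<phi> v - \<psi> t \<phi> t\<bar> < \<delta>)) \<and>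
        norm (u - v) \<ge> (2 - \<eta>) * norm t" for t
    proof (cases "t = 0")
      case False
      have "\<exists>u v. norm u \<le> norm t \<and> norm v \<le> norm t \<and>
        (\<forall>\<phi>\<in>F. \<bar>\<psi> t \<phi> u - \<psi> t \<phi> t\<bar> < \<delta> \<and> \<bar>\<psi> t \<phi> v - \<psi> t \<phi> t\<bar> < \<delta>) \<and>
        norm (u - v) \<ge> (2 - \<eta>) * norm t"
        by (rule D2P_move[OF X F(1) \<psi>[OF False] \<delta> \<eta>(1)])
      then show ?thesis using False by simp
    qed (auto intro!: exI[of _ 0])
    then have "\<forall>t. \<exists>u v. norm u \<le> norm t \<and> norm v \<le> norm t \<and>
        (t \<noteq> 0 \<longrightarrow> (\<forall>\<phi>\<in>F. \<bar>\<psi> t \<phi> u - \<psi> t \<phi> t\<bar> < \<delta> \<and> \<bar>\<psi> t \<phi> v - \<psi> t \<phi> t\<bar> < \<delta>)) \<and>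
        norm (u - v) \<ge> (2 - \<eta>) * norm t" by (rule allI)
    then obtain u v where "\<forall>t. norm (u t) \<le> norm t \<and> norm (v t) \<le> norm t \<and>
        (t \<noteq> 0 \<longrightarrow> (\<forall>\<phi>\<in>F. \<bar>\<psi> t \<phi> (u t) - \<psi> t \<phi> t\<bar> < \<delta> \<and> \<bar>\<psi> t \<phi> (v t) - \<psi> t \<phi> t\<bar> < \<delta>)) \<and>
        norm (u t - v t) \<ge> (2 - \<eta>) * norm t"
      unfolding choice_iff by blast
    then have uv: "\<And>t. norm (u t) \<le> norm t" "\<And>t. norm (v t) \<le> norm t"
      "\<And>t. t \<noteq> 0 \<Longrightarrow> \<forall>\<phi>\<in>F. \<bar>\<psi> t \<phi> (u t) - \<psi> t \<phi> t\<bar> < \<delta> \<and> \<bar>\<psi> t \<phi> (v t) - \<psi> t \<phi> t\<bar> < \<delta>"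
      "\<And>t. norm (u t - v t) \<ge> (2 - \<eta>) * norm t"
      by blast+
    have inW: "(\<lambda>s. w (g s)) \<in> W"
      if w: "\<And>t. norm (w t) \<le> norm t" "\<And>t \<phi>. t \<noteq> 0 \<Longrightarrow> \<phi> \<in> F \<Longrightarrow> \<bar>\<psi> t \<phi> (w t) - \<psi> t \<phi> t\<bar> < \<delta>" for w
    proof -
      have w0: "w 0 = 0" using w(1)[of 0] by simp
      have wV: "(\<lambda>s. w (g s)) \<in> V" by (rule label_mem[where h = w, OF gl w0])
      have "N (\<lambda>s. w (g s)) \<le> 1"
        using norm_mono[OF gV wV w(1)] g(2) by linarith
      moreover have "\<bar>\<phi> (\<lambda>s. w (g s)) - \<phi> f\<bar> < \<epsilon>0" if "\<phi> \<in> F" for \<phi>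
      proof -
        have "\<phi> (\<lambda>s. w (g s)) - \<phi> g = (\<Sum>t\<in>R. \<psi> t \<phi> (w t) - \<psi> t \<phi> t)"
          using decomp[of _ "\<lambda>x. x", OF that] decomp[of _ w, OF that w0] by (simp add: sum_subtractf)
        also have "\<bar>\<dots>\<bar> \<le> (\<Sum>t\<in>R. \<delta>)"
          using w(2)[OF _ that] by (intro order_trans[OF sum_abs] sum_mono less_imp_le) (auto simp: R_def)
        finally have "\<bar>\<phi> (\<lambda>s. w (g s)) - \<phi> g\<bar> \<le> \<epsilon>0 / 4" using card by simp
        then show ?thesis using \<phi>g[OF that] F(3) by linarith
      qed
      ultimately show ?thesis using wV FW by (auto simp: unit_ball_def)
    qed
    have "N ((\<lambda>s. u (g s)) - (\<lambda>s. v (g s))) \<ge> (2 - \<eta>) * N g"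
      using \<eta>(2) uv(1)[of 0] uv(2)[of 0] by (intro norm_diff_label g(1) uv(4)) auto
    moreover have "(2 - \<eta>) * N g \<ge> (2 - \<eta>) * (1 - \<eta>)"
      using Ng \<eta>(2) by (intro mult_left_mono) auto
    moreover have "(2 - \<eta>) * (1 - \<eta>) = 2 - 3 * \<eta> + \<eta> * \<eta>" by (simp add: algebra_simps)
    moreover have "\<eta> * \<eta> > 0" using \<eta>(1) by simp
    ultimately have "N ((\<lambda>s. u (g s)) - (\<lambda>s. v (g s))) > 2 - \<epsilon>" using \<eta>(1,3) by linarith
    then show "\<exists>y\<in>W. \<exists>z\<in>W. N (y - z) > 2 - \<epsilon>"
      using inW[of u] inW[of v] uv by blast
  qed
qed

end

section \<open>The strong diameter two property under an additive norm\<close>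

context kothe_bochner_dense
begin

text \<open>Pointwise, the two combinations differ by almost twice the weighted sum k of the norms
  of the \<open>g i\<close>. Each \<open>g i\<close> has norm close to 1, but a convex combination
  of such scalar functions may have much smaller norm, as with disjoint supports in a sup norm.
  Additivity rules this out.\<close>

theorem SD2P_kothe_bochner:
  assumes X: "SD2P (UNIV :: 'x set) norm"
    and additive: "\<And>f g. f \<in> E \<Longrightarrow> g \<in> E \<Longrightarrow> (\<And>s. 0 \<le> f s) \<Longrightarrow> (\<And>s. 0 \<le> g s) \<Longrightarrow> NE (f + g) = NE f + NE g"
  shows "SD2P V N"
  unfolding SD2P_def
proof (intro allI impI)
  fix n :: nat and w :: "nat \<Rightarrow> real" and \<phi> :: "nat \<Rightarrow> ('s \<Rightarrow> 'x) \<Rightarrow> real" and \<alpha> :: "nat \<Rightarrow> real"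
  assume "n \<ge> 1 \<and> (\<forall>i<n. w i \<ge> 0) \<and> (\<Sum>i<n. w i) = 1 \<and>
      (\<forall>i<n. dual_fun V N (\<phi> i) \<and> dual_norm V N (\<phi> i) = 1 \<and> \<alpha> i > 0)"
  then have n: "n \<ge> 1" and w: "\<And>i. i < n \<Longrightarrow> w i \<ge> 0" "(\<Sum>i<n. w i) = 1"
    and \<phi>: "\<And>i. i < n \<Longrightarrow> dual_fun V N (\<phi> i)" "\<And>i. i < n \<Longrightarrow> dual_norm V N (\<phi> i) = 1"
    and \<alpha>: "\<And>i. i < n \<Longrightarrow> \<alpha> i > 0" by auto
  let ?W = "{\<Sum>i<n. w i *\<^sub>R z i | z. \<forall>i<n. z i \<in> slice V N (\<phi> i) (\<alpha> i)}"
  show "set_diam N ?W = 2"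
  proof (rule set_diam_eq_2I)
    show "?W \<subseteq> unit_ball V N"
      using unit_ball_convex_sum[OF w] by (auto simp: slice_def)
    fix \<epsilon> :: real assume "\<epsilon> > 0"
    define \<eta> where "\<eta> = Min (insert 1 (insert (\<epsilon> / 4) (\<alpha> ` {..<n})))"
    have \<eta>: "\<eta> > 0" "\<eta> \<le> 1" "4 * \<eta> \<le> \<epsilon>" "\<And>i. i < n \<Longrightarrow> \<eta> \<le> \<alpha> i"
    proof -
      show "\<eta> > 0" using \<alpha> \<open>\<epsilon> > 0\<close> by (auto simp: \<eta>_def)
      have "\<eta> \<le> \<epsilon> / 4" unfolding \<eta>_def by (rule Min_le) auto
      then show "4 * \<eta> \<le> \<epsilon>" by simp
      show "\<eta> \<le> \<alpha> i" if "i < n" for i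
        unfolding \<eta>_def using that by (intro Min_le) auto
    qed (auto simp: \<eta>_def)
    have "\<forall>i\<in>{..<n}. \<exists>g. simple_vfun M g \<and> N g \<le> 1 \<and> \<phi> i g > 1 - \<eta> / 2 \<and> N g > 1 - \<eta> / 2"
    proof
      fix i assume "i \<in> {..<n}"
      then have "i < n" by simp
      obtain g where "simple_vfun M g" "N g \<le> 1" "\<phi> i g > 1 - \<eta> / 2" "N g > 1 - \<eta> / 2"
        using simple_in_slice[OF \<phi>(1,2)[OF \<open>i < n\<close>], of "\<eta> / 2"] \<eta>(1) by auto
      then show "\<exists>g. simple_vfun M g \<and> N g \<le> 1 \<and> \<phi> i g > 1 - \<eta> / 2 \<and> N g > 1 - \<eta> / 2" by blast
    qed
    then obtain g where g: "\<And>i. i < n \<Longrightarrow> simple_vfun M (g i)" "\<And>i. i < n \<Longrightarrow> N (g i) \<le> 1"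
      and \<phi>g: "\<And>i. i < n \<Longrightarrow> \<phi> i (g i) > 1 - \<eta> / 2" and Ng: "\<And>i. i < n \<Longrightarrow> N (g i) > 1 - \<eta> / 2"
      unfolding bchoice_iff by auto
    have gV: "g i \<in> V" if "i < n" for i using simple_mem[OF g(1)[OF that]] .
    \<comment> \<open>On a fibre of T all the \<open>g i\<close> are constant at once, and the label
      records their values.\<close>
    define T where "T = (\<lambda>s i. if i < n then g i s else 0)"
    have Tl: "finite_label M T (\<lambda>i. 0)"
      unfolding T_def using g(1) by (intro finite_label_tuple) (auto simp: simple_vfun_iff)
    have Tg: "g i = (\<lambda>s. T s i)" if "i < n" for i using that by (auto simp: T_def)
    define R where "R = range T - {\<lambda>i. 0}"
    define \<psi> where "\<psi> t i c = \<phi> i (\<lambda>s. indicator (T -` {t}) s *\<^sub>R c)" for t i c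
    have \<psi>: "dual_fun UNIV norm (\<psi> t i)" if "t \<noteq> (\<lambda>i. 0)" "i < n" for t i
      unfolding \<psi>_def using finite_label_fibre[OF Tl that(1)] by (rule fibre_functional[OF \<phi>(1)[OF that(2)]])
    have decomp: "\<phi> i (\<lambda>s. h (T s)) = (\<Sum>t\<in>R. \<psi> t i (h t))" if "i < n" "h (\<lambda>i. 0) = 0" for h i
      unfolding \<psi>_def R_def by (rule dual_fun_label[where h = h, OF \<phi>(1)[OF that(1)] Tl that(2)])
    have "0 < n" using n by simp
    \<comment> \<open>As n is at least 1, index 0 is available; its functional is positive at
      \<open>g 0\<close> and hence nonzero on some fibre of T.\<close>
    have nz: "\<phi> 0 (\<lambda>s. T s 0) \<noteq> 0" using \<phi>g[OF \<open>0 < n\<close>] Tg[OF \<open>0 < n\<close>] \<eta>(2) by simp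
    obtain \<psi>0 and x0 :: 'x where \<psi>0: "dual_fun UNIV norm \<psi>0" "\<psi>0 x0 \<noteq> 0"
      by (rule nonzero_fibre_functional[where h = "\<lambda>t. t 0", OF \<phi>(1)[OF \<open>0 < n\<close>] Tl refl nz])
    define \<delta> where "\<delta> = \<eta> / (2 * (real (card R) + 1))"
    have \<delta>: "\<delta> > 0" using \<eta>(1) by (simp add: \<delta>_def)
    have card: "real (card R) * \<delta> \<le> \<eta> / 2"
      using \<eta>(1) by (simp add: \<delta>_def field_simps)
    \<comment> \<open>All n values of a label are moved together, because the strong property
      separates only the convex combinations and not the individual points.\<close>
    let ?P = "\<lambda>t u v. (\<forall>i<n. norm (u i) \<le> norm (t i) \<and> norm (v i) \<le> norm (t i) \<and>
          (t \<noteq> (\<lambda>i. 0) \<longrightarrow> \<psi> t i (u i) > \<psi> t i (t i) - \<delta> \<and> \<psi> t i (v i) > \<psi> t i (t i) - \<delta>)) \<and>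
        norm (\<Sum>i<n. w i *\<^sub>R (u i - v i)) \<ge> (2 - \<eta>) * (\<Sum>i<n. w i * norm (t i))"
    have "\<exists>u v. ?P t u v" for t
    proof (cases "t = (\<lambda>i. 0)")
      case True
      then show ?thesis by (intro exI[of _ "\<lambda>i. 0"]) simp
    next
      case False
      have "\<exists>u v. (\<forall>i<n. norm (u i) \<le> norm (t i) \<and> norm (v i) \<le> norm (t i) \<and>
          \<psi> t i (u i) > \<psi> t i (t i) - \<delta> \<and> \<psi> t i (v i) > \<psi> t i (t i) - \<delta>) \<and>
        norm (\<Sum>i<n. w i *\<^sub>R (u i - v i)) \<ge> (2 - \<eta>) * (\<Sum>i<n. w i * norm (t i))"
        by (rule SD2P_move[OF X n _ _ \<psi>0 \<delta> \<eta>(1)]) (use w(1) \<psi>[OF False] in auto)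
      then show ?thesis using False by simp
    qed
    then have "\<forall>t. \<exists>u v. ?P t u v" by (rule allI)
    then obtain u v where uv: "\<forall>t. ?P t (u t) (v t)"
      unfolding choice_iff by blast
    have slice: "(\<lambda>s. h (T s) i) \<in> slice V N (\<phi> i) (\<alpha> i)"
      if i: "i < n" and h: "\<And>t. norm (h t i) \<le> norm (t i)" "\<And>t. t \<noteq> (\<lambda>i. 0) \<Longrightarrow> \<psi> t i (h t i) > \<psi> t i (t i) - \<delta>"
      for i and h :: "(nat \<Rightarrow> 'x) \<Rightarrow> nat \<Rightarrow> 'x"
    proof -
      have h0: "h (\<lambda>i. 0) i = 0" using h(1)[of "\<lambda>i. 0"] by simp
      have "(\<Sum>t\<in>R. \<psi> t i (t i) - \<delta>) \<le> (\<Sum>t\<in>R. \<psi> t i (h t i))"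
        using h(2) by (intro sum_mono less_imp_le) (auto simp: R_def)
      then have "\<phi> i (g i) - real (card R) * \<delta> \<le> \<phi> i (\<lambda>s. h (T s) i)"
        using decomp[of i "\<lambda>t. t i", OF i refl] decomp[of i "\<lambda>t. h t i", OF i h0] Tg[OF i]
        by (simp add: sum_subtractf)
      then have "\<phi> i (\<lambda>s. h (T s) i) > 1 - \<alpha> i" using \<phi>g[OF i] card \<eta>(4)[OF i] by linarith
      moreover have hV: "(\<lambda>s. h (T s) i) \<in> V"
        by (rule label_mem[where h = "\<lambda>t. h t i", OF Tl h0])
      moreover have "N (\<lambda>s. h (T s) i) \<le> N (g i)"
        using h(1) Tg[OF i] by (intro norm_mono gV i hV) simp
      then have "N (\<lambda>s. h (T s) i) \<le> 1" using g(2)[OF i] by linarith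
      ultimately show ?thesis by (simp add: slice_def unit_ball_def)
    qed
    define y where "y = (\<Sum>i<n. w i *\<^sub>R (\<lambda>s. u (T s) i))"
    define z where "z = (\<Sum>i<n. w i *\<^sub>R (\<lambda>s. v (T s) i))"
    have su: "(\<lambda>s. u (T s) i) \<in> slice V N (\<phi> i) (\<alpha> i)" and sv: "(\<lambda>s. v (T s) i) \<in> slice V N (\<phi> i) (\<alpha> i)"
      if "i < n" for i
      using uv that by (auto intro!: slice)
    have yW: "y \<in> ?W"
      unfolding y_def using su by (intro CollectI exI[of _ "\<lambda>i s. u (T s) i"]) simp
    have zW: "z \<in> ?W"
      unfolding z_def using sv by (intro CollectI exI[of _ "\<lambda>i s. v (T s) i"]) simp
    have yzV: "y - z \<in> V"
      unfolding y_def z_def using su sv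
      by (intro diff_mem sum_mem scale_mem) (auto simp: slice_def unit_ball_def)
    define k where "k = (\<Sum>i<n. w i *\<^sub>R (\<lambda>s. norm (g i s)))"
    have gE: "(\<lambda>s. norm (g i s)) \<in> E" if "i < n" for i
      using gV[OF that] by (simp add: V_eq kothe_bochner_def)
    have kE: "k \<in> E" unfolding k_def using gE by (intro E.sum_mem E.scale_mem) auto
    \<comment> \<open>Additivity is applied along partial sums; the bound on m is kept because the
      \<open>g i\<close> are known to be in V for indices below n only.\<close>
    have "m \<le> n \<Longrightarrow> NE (\<Sum>i<m. w i *\<^sub>R (\<lambda>s. norm (g i s))) = (\<Sum>i<m. w i * N (g i))" for m
    proof (induction m)
      case 0
      then show ?case by (simp add: E.seminorm_zero[unfolded zero_fun_def])
    next
      case (Suc m)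
      have "NE ((\<Sum>i<m. w i *\<^sub>R (\<lambda>s. norm (g i s))) + w m *\<^sub>R (\<lambda>s. norm (g m s)))
          = NE (\<Sum>i<m. w i *\<^sub>R (\<lambda>s. norm (g i s))) + NE (w m *\<^sub>R (\<lambda>s. norm (g m s)))"
        using Suc.prems gE w(1)
        by (intro additive E.sum_mem E.scale_mem)
          (auto simp: sum_fun_eval scaleR_fun_def intro!: sum_nonneg mult_nonneg_nonneg)
      moreover have "NE (w m *\<^sub>R (\<lambda>s. norm (g m s))) = w m * N (g m)"
        using E.homogeneous[OF gE, of m "w m"] Suc.prems w(1)[of m] by (simp add: N_eq kothe_bochner_norm_def)
      ultimately show ?case using Suc by (simp add: plus_fun_def)
    qed
    then have "NE k = (\<Sum>i<n. w i * N (g i))" by (simp add: k_def)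
    moreover have "(\<Sum>i<n. w i * N (g i)) \<ge> (\<Sum>i<n. w i * (1 - \<eta> / 2))"
      using w(1) Ng by (intro sum_mono mult_left_mono) (auto intro: less_imp_le)
    moreover have "(\<Sum>i<n. w i * (1 - \<eta> / 2)) = 1 - \<eta> / 2"
      using w(2) by (simp flip: sum_distrib_right)
    ultimately have NEk: "NE k \<ge> 1 - \<eta> / 2" by simp
    \<comment> \<open>The estimate chosen for the tuple \<open>T s\<close> is used at the point s;
      solidity of \<open>NE\<close> then lifts it to the function norm.\<close>
    have pointwise: "\<bar>((2 - \<eta>) *\<^sub>R k) s\<bar> \<le> \<bar>norm ((y - z) s)\<bar>" for s
    proof -
      have "k s = (\<Sum>i<n. w i * norm (T s i))"
        unfolding k_def sum_fun_eval scaleR_fun_def by (intro sum.cong) (auto simp: T_def)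
      moreover have "(y - z) s = (\<Sum>i<n. w i *\<^sub>R (u (T s) i - v (T s) i))"
        by (simp add: y_def z_def sum_fun_eval scaleR_fun_def scaleR_diff_right sum_subtractf)
      moreover have "norm (\<Sum>i<n. w i *\<^sub>R (u (T s) i - v (T s) i)) \<ge> (2 - \<eta>) * (\<Sum>i<n. w i * norm (T s i))"
        using uv by blast
      moreover have "(2 - \<eta>) * (\<Sum>i<n. w i * norm (T s i)) \<ge> 0"
        using \<eta>(2) w(1) by (intro mult_nonneg_nonneg sum_nonneg) auto
      ultimately show ?thesis by (simp add: scaleR_fun_def)
    qed
    have "(2 - \<eta>) * (1 - \<eta> / 2) \<le> (2 - \<eta>) * NE k"
      using NEk \<eta>(2) by (intro mult_left_mono) auto
    also have "\<dots> = NE ((2 - \<eta>) *\<^sub>R k)"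
      using E.homogeneous[OF kE, of "2 - \<eta>"] \<eta>(2) by simp
    also have "\<dots> \<le> NE (\<lambda>s. norm ((y - z) s))"
      using yzV pointwise E.scale_mem[OF kE]
      by (intro solid_le E_measurable AE_I2) (auto simp: V_eq kothe_bochner_def)
    also have "\<dots> = N (y - z)" by (simp add: N_eq kothe_bochner_norm_def)
    finally have "(2 - \<eta>) * (1 - \<eta> / 2) \<le> N (y - z)" .
    moreover have "(2 - \<eta>) * (1 - \<eta> / 2) = 2 - 2 * \<eta> + \<eta> * \<eta> / 2" by (simp add: field_simps)
    moreover have "\<eta> * \<eta> > 0" using \<eta>(1) by simp
    ultimately have "N (y - z) > 2 - \<epsilon>" using \<eta>(1,3) by linarith
    then show "\<exists>y\<in>?W. \<exists>z\<in>?W. N (y - z) > 2 - \<epsilon>" using yW zW by blast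
  qed
qed

end

section \<open>Lebesgue--Bochner spaces\<close>

definition Lp_real :: "'s measure \<Rightarrow> real \<Rightarrow> ('s \<Rightarrow> real) set" where
  "Lp_real M p = {f \<in> borel_measurable M. integrable M (\<lambda>s. \<bar>f s\<bar> powr p)}"

definition Lp_real_norm :: "'s measure \<Rightarrow> real \<Rightarrow> ('s \<Rightarrow> real) \<Rightarrow> real" where
  "Lp_real_norm M p f = (\<integral>s. \<bar>f s\<bar> powr p \<partial>M) powr (1 / p)"

text \<open>For positive arguments this is convexity of the power. If one argument is 0, it reduces
  to \<open>c powr p \<le> c\<close> for a weight c between 0 and 1.\<close>

lemma powr_convex_nonneg:
  fixes x y :: real
  assumes "p \<ge> 1" "x \<ge> 0" "y \<ge> 0" "a \<ge> 0" "b \<ge> 0" "a + b = 1"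
  shows "(a * x + b * y) powr p \<le> a * x powr p + b * y powr p"
proof -
  have sub: "c powr p \<le> c" if "0 \<le> c" "c \<le> 1" for c :: real
    using powr_mono'[OF assms(1) that] that(1) by simp
  consider "x = 0" | "y = 0" | "x > 0" "y > 0" using assms(2,3) by linarith
  then show ?thesis
  proof cases
    case 1
    then show ?thesis using sub[of b] assms by (simp add: powr_mult mult_right_mono)
  next
    case 2
    then show ?thesis using sub[of a] assms by (simp add: powr_mult mult_right_mono)
  next
    case 3
    have "a = 1 - b" using assms(6) by simp
    then show ?thesis
      using convex_onD[OF powr_convex[OF assms(1)], of b x y] 3 assms(4,5) by simp
  qed
qed

text \<open>Pointwise form of Minkowski's inequality: the quotient of |x| + |y| by
  \<open>a + b\<close> is a convex combination of |x| / a and |y| / b. The parameters a and b will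
  stand for the norms of the two functions.\<close>

lemma powr_add_le:
  fixes x y :: real
  assumes "p \<ge> 1" "a > 0" "b > 0"
  shows "\<bar>x + y\<bar> powr p \<le> (a + b) powr p * (a / (a + b) * (\<bar>x\<bar> powr p / a powr p) + b / (a + b) * (\<bar>y\<bar> powr p / b powr p))"
proof -
  have "\<bar>x + y\<bar> / (a + b) \<le> a / (a + b) * (\<bar>x\<bar> / a) + b / (a + b) * (\<bar>y\<bar> / b)"
    using assms by (simp add: divide_right_mono flip: add_divide_distrib)
  then have "(\<bar>x + y\<bar> / (a + b)) powr p \<le> (a / (a + b) * (\<bar>x\<bar> / a) + b / (a + b) * (\<bar>y\<bar> / b)) powr p"
    using assms by (intro powr_mono2) auto
  also have "\<dots> \<le> a / (a + b) * (\<bar>x\<bar> / a) powr p + b / (a + b) * (\<bar>y\<bar> / b) powr p"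
    using assms by (intro powr_convex_nonneg) (auto simp flip: add_divide_distrib)
  finally have "\<bar>x + y\<bar> powr p / (a + b) powr p
      \<le> a / (a + b) * (\<bar>x\<bar> powr p / a powr p) + b / (a + b) * (\<bar>y\<bar> powr p / b powr p)"
    by (simp only: powr_divide)
  moreover have "(a + b) powr p > 0" using assms by simp
  ultimately show ?thesis by (simp add: pos_divide_le_eq mult.commute)
qed

lemma Lp_real_add:
  assumes "p \<ge> 1" "f \<in> Lp_real M p" "g \<in> Lp_real M p"
  shows "f + g \<in> Lp_real M p"
proof -
  have [measurable]: "f \<in> borel_measurable M" "g \<in> borel_measurable M"
    and int: "integrable M (\<lambda>s. \<bar>f s\<bar> powr p)" "integrable M (\<lambda>s. \<bar>g s\<bar> powr p)"
    using assms by (auto simp: Lp_real_def)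
  have "integrable M (\<lambda>s. \<bar>f s + g s\<bar> powr p)"
  proof (rule Bochner_Integration.integrable_bound)
    \<comment> \<open>The majorant is the right-hand side of \<open>powr_add_le\<close> for
      \<open>a = b = 1\<close>, left unsimplified.\<close>
    show "integrable M (\<lambda>s. (1 + 1) powr p * (1 / (1 + 1) * (\<bar>f s\<bar> powr p / 1 powr p) + 1 / (1 + 1) * (\<bar>g s\<bar> powr p / 1 powr p)))"
      using int by (intro integrable_mult_right Bochner_Integration.integrable_add) auto
    show "AE s in M. norm (\<bar>f s + g s\<bar> powr p) \<le> norm ((1 + 1) powr p *
        (1 / (1 + 1) * (\<bar>f s\<bar> powr p / 1 powr p) + 1 / (1 + 1) * (\<bar>g s\<bar> powr p / 1 powr p)))"
    proof (rule AE_I2)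
      fix s
      show "norm (\<bar>f s + g s\<bar> powr p) \<le> norm ((1 + 1) powr p *
        (1 / (1 + 1) * (\<bar>f s\<bar> powr p / 1 powr p) + 1 / (1 + 1) * (\<bar>g s\<bar> powr p / 1 powr p)))"
        using powr_add_le[OF assms(1), of 1 1 "f s" "g s"] by simp
    qed
  qed measurable
  then show ?thesis by (simp add: Lp_real_def plus_fun_def)
qed

lemma Lp_real_minkowski:
  assumes "p \<ge> 1" "f \<in> Lp_real M p" "g \<in> Lp_real M p"
  shows "Lp_real_norm M p (f + g) \<le> Lp_real_norm M p f + Lp_real_norm M p g"
proof (rule field_le_epsilon)
  fix e :: real assume "e > 0"
  \<comment> \<open>The extra \<open>e / 2\<close> keeps the divisor positive when the norm is 0.
    Since a and b bound the norms, each normalised integral is at most 1.\<close>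
  define a where "a = Lp_real_norm M p f + e / 2"
  define b where "b = Lp_real_norm M p g + e / 2"
  have ab: "a > 0" "b > 0" using \<open>e > 0\<close> by (auto simp: a_def b_def Lp_real_norm_def add_nonneg_pos)
  have int: "integrable M (\<lambda>s. \<bar>f s\<bar> powr p)" "integrable M (\<lambda>s. \<bar>g s\<bar> powr p)"
    using assms by (auto simp: Lp_real_def)
  have int_le: "(\<integral>s. \<bar>h s\<bar> powr p \<partial>M) \<le> c powr p" if "Lp_real_norm M p h \<le> c" for h and c :: real
  proof -
    have "(Lp_real_norm M p h) powr p \<le> c powr p"
      using that assms(1) by (intro powr_mono2) (auto simp: Lp_real_norm_def)
    moreover have "(Lp_real_norm M p h) powr p = (\<integral>s. \<bar>h s\<bar> powr p \<partial>M)"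
      using assms(1) by (simp add: Lp_real_norm_def powr_powr)
    ultimately show ?thesis by simp
  qed
  let ?bd = "\<lambda>s. (a + b) powr p * (a / (a + b) * (\<bar>f s\<bar> powr p / a powr p) + b / (a + b) * (\<bar>g s\<bar> powr p / b powr p))"
  have "(\<integral>s. \<bar>(f + g) s\<bar> powr p \<partial>M) \<le> (\<integral>s. ?bd s \<partial>M)"
    using Lp_real_add[OF assms] int powr_add_le[OF assms(1) ab]
    by (intro integral_mono) (auto simp: Lp_real_def plus_fun_def)
  also have "\<dots> = (a + b) powr p * (a / (a + b) * ((\<integral>s. \<bar>f s\<bar> powr p \<partial>M) / a powr p)
      + b / (a + b) * ((\<integral>s. \<bar>g s\<bar> powr p \<partial>M) / b powr p))"
    using int by simp
  also have "\<dots> \<le> (a + b) powr p * (a / (a + b) * 1 + b / (a + b) * 1)"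
    using ab int_le[of f a] int_le[of g b] \<open>e > 0\<close>
    by (intro mult_left_mono add_mono) (auto simp: a_def b_def)
  also have "\<dots> = (a + b) powr p"
    using ab by (simp flip: add_divide_distrib)
  finally have "Lp_real_norm M p (f + g) \<le> ((a + b) powr p) powr (1 / p)"
    unfolding Lp_real_norm_def using assms(1) by (intro powr_mono2) auto
  also have "\<dots> = a + b" using ab assms(1) by (simp add: powr_powr)
  finally show "Lp_real_norm M p (f + g) \<le> Lp_real_norm M p f + Lp_real_norm M p g + e"
    by (simp add: a_def b_def)
qed

lemma (in complete_measure) Lp_real_kothe_seminorm:
  assumes "p \<ge> 1"
  shows "kothe_seminorm M (Lp_real M p) (Lp_real_norm M p)"
proof
  show "0 \<in> Lp_real M p" by (simp add: Lp_real_def zero_fun_def)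
  fix f g :: "'a \<Rightarrow> real" and a :: real
  assume f: "f \<in> Lp_real M p"
  then have [measurable]: "f \<in> borel_measurable M" and int: "integrable M (\<lambda>s. \<bar>f s\<bar> powr p)"
    by (auto simp: Lp_real_def)
  show "f \<in> borel_measurable M" by measurable
  show "a *\<^sub>R f \<in> Lp_real M p"
    using int by (auto simp: Lp_real_def scaleR_fun_def abs_mult powr_mult)
  show "Lp_real_norm M p (a *\<^sub>R f) = \<bar>a\<bar> * Lp_real_norm M p f"
    using assms by (simp add: Lp_real_norm_def scaleR_fun_def abs_mult powr_mult powr_powr)
  show "AE s in M. f s = 0" if "Lp_real_norm M p f = 0"
  proof -
    have "(\<integral>s. \<bar>f s\<bar> powr p \<partial>M) = 0" using that by (simp add: Lp_real_norm_def)
    then have "AE s in M. \<bar>f s\<bar> powr p = 0"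
      using integral_nonneg_eq_0_iff_AE[OF int] by simp
    then show ?thesis by simp
  qed
  show "f + g \<in> Lp_real M p" if "g \<in> Lp_real M p" by (rule Lp_real_add[OF assms f that])
  show "Lp_real_norm M p (f + g) \<le> Lp_real_norm M p f + Lp_real_norm M p g" if "g \<in> Lp_real M p"
    by (rule Lp_real_minkowski[OF assms f that])
  assume g[measurable]: "g \<in> borel_measurable M" and le: "AE s in M. \<bar>g s\<bar> \<le> \<bar>f s\<bar>"
  have AE: "AE s in M. \<bar>g s\<bar> powr p \<le> \<bar>f s\<bar> powr p"
    using le by eventually_elim (use assms in \<open>auto intro!: powr_mono2\<close>)
  have intg: "integrable M (\<lambda>s. \<bar>g s\<bar> powr p)"
  proof (rule Bochner_Integration.integrable_bound[OF int])
    show "AE s in M. norm (\<bar>g s\<bar> powr p) \<le> norm (\<bar>f s\<bar> powr p)" using AE by simp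
  qed measurable
  then show "g \<in> Lp_real M p" using g by (simp add: Lp_real_def)
  show "Lp_real_norm M p g \<le> Lp_real_norm M p f"
    unfolding Lp_real_norm_def using assms integral_mono_AE[OF intg int AE]
    by (intro powr_mono2) auto
next
  fix A assume "A \<in> fmeasurable M"
  then have A: "A \<in> sets M" "emeasure M A < \<infinity>" by (auto simp: fmeasurable_def)
  have "(\<lambda>s. \<bar>indicator A s\<bar> powr p) = (indicator A :: 'a \<Rightarrow> real)" by (auto simp: indicator_def)
  then show "indicator A \<in> Lp_real M p" using A by (simp add: Lp_real_def)
qed

text \<open>The definitions differ in that one side demands measurability of the norm; it is
  recovered from the integrable p-th power by taking the p-th root.\<close>

lemma Lp_bochner_eq:
  assumes "p \<ge> 1"
  shows "Lp_bochner M p = kothe_bochner M (Lp_real M p)"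
proof -
  have "(\<lambda>s. norm (f s)) \<in> borel_measurable M" if "integrable M (\<lambda>s. norm (f s) powr p)" for f :: "'a \<Rightarrow> 'b"
  proof -
    have "(\<lambda>s. (norm (f s) powr p) powr (1 / p)) \<in> borel_measurable M"
      using borel_measurable_integrable[OF that] by measurable
    moreover have "(norm (f s) powr p) powr (1 / p) = norm (f s)" for s
      using assms by (simp add: powr_powr)
    ultimately show ?thesis by simp
  qed
  then show ?thesis by (auto simp: Lp_bochner_def kothe_bochner_def Lp_real_def)
qed

lemma Lp_bochner_norm_eq: "Lp_bochner_norm M p = kothe_bochner_norm (Lp_real_norm M p)"
  by (auto simp: Lp_bochner_norm_def kothe_bochner_norm_def Lp_real_norm_def)

text \<open>The simple functions from Bochner measurability converge almost everywhere, without any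
  bound. Cutting them off where they exceed a multiple of the norm of f supplies a majorant for
  dominated convergence.\<close>

lemma (in complete_measure) Lp_bochner_simple_dense:
  assumes "p \<ge> 1"
  shows "simple_dense M (Lp_bochner_norm M p) (Lp_bochner M p :: ('a \<Rightarrow> 'x::real_normed_vector) set)"
  unfolding simple_dense_def
proof (intro ballI allI impI)
  fix f :: "'a \<Rightarrow> 'x" and \<epsilon> :: real assume f: "f \<in> Lp_bochner M p" and "\<epsilon> > 0"
  then have bm: "bochner_measurable M f" and int: "integrable M (\<lambda>s. norm (f s) powr p)"
    by (auto simp: Lp_bochner_def)
  obtain u where u: "\<And>n. simple_vfun M (u n)" and lim: "AE s in M. (\<lambda>n. u n s) \<longlonglongrightarrow> f s"
    using bm unfolding bochner_measurable_def by blast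
  note [measurable] = bochner_measurable_norm[OF bm] simple_vfun_norm_measurable[OF u]
  \<comment> \<open>It matters only that 2 exceeds 1: where f is nonzero, the converging values
    eventually obey the bound. Where f is zero, the truncated functions vanish.\<close>
  define B where "B n = {s \<in> space M. norm (u n s) \<le> 2 * norm (f s)}" for n
  have B: "B n \<in> sets M" for n unfolding B_def by measurable
  define v where "v n s = (if s \<in> B n then u n s else 0)" for n s
  have v: "simple_vfun M (v n)" for n
    unfolding simple_vfun_iff v_def using u B by (intro finite_label_restrict) (auto simp: simple_vfun_iff)
  have v_le: "norm (v n s) \<le> 2 * norm (f s)" for n s by (auto simp: v_def B_def)
  have v_lim: "AE s in M. (\<lambda>n. v n s) \<longlonglongrightarrow> f s"
    using lim AE_space
  proof eventually_elim
    case (elim s)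
    show ?case
    proof (cases "f s = 0")
      case True
      then have "v n s = 0" for n using v_le[of n s] by simp
      then show ?thesis using True by simp
    next
      case False
      then have "eventually (\<lambda>n. norm (u n s) < 2 * norm (f s)) sequentially"
        using order_tendstoD(2)[OF tendsto_norm[OF elim(1)], of "2 * norm (f s)"] by simp
      then have "eventually (\<lambda>n. u n s = v n s) sequentially"
        by eventually_elim (use elim(2) in \<open>auto simp: v_def B_def\<close>)
      then show ?thesis using elim(1) by (rule Lim_transform_eventually[rotated])
    qed
  qed
  have diff: "bochner_measurable M (f - v n)" for n
    using bochner_measurable_add[OF bm bochner_measurable_scale[OF simple_vfun_bochner_measurable[OF v]], of "-1" n]
    by simp
  have "(\<lambda>n. \<integral>s. norm ((f - v n) s) powr p \<partial>M) \<longlonglongrightarrow> (\<integral>s. 0 \<partial>M)"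
  \<comment> \<open>The factor 3 arises as 1 + 2, from f and from the bound on the truncated
    functions.\<close>
  proof (rule integral_dominated_convergence[where w = "\<lambda>s. 3 powr p * norm (f s) powr p"])
    show "(\<lambda>s. norm ((f - v n) s) powr p) \<in> borel_measurable M" for n
      using bochner_measurable_norm[OF diff] by measurable
    show "integrable M (\<lambda>s. 3 powr p * norm (f s) powr p)" using int by simp
    show "AE s in M. (\<lambda>n. norm ((f - v n) s) powr p) \<longlonglongrightarrow> 0"
      using v_lim
    proof eventually_elim
      case (elim s)
      have "(\<lambda>n. norm (f s - v n s)) \<longlonglongrightarrow> norm (f s - f s)"
        by (intro tendsto_intros elim)
      then have "(\<lambda>n. norm ((f - v n) s)) \<longlonglongrightarrow> 0" by simp
      then show ?case
        by (rule tendsto_zero_powrI) (use assms in auto)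
    qed
    show "AE s in M. norm (norm ((f - v n) s) powr p) \<le> 3 powr p * norm (f s) powr p" for n
    proof (rule AE_I2)
      fix s
      have "norm ((f - v n) s) \<le> 3 * norm (f s)"
        using norm_triangle_ineq4[of "f s" "v n s"] v_le[of n s] by simp
      then have "norm ((f - v n) s) powr p \<le> (3 * norm (f s)) powr p"
        using assms by (intro powr_mono2) auto
      then show "norm (norm ((f - v n) s) powr p) \<le> 3 powr p * norm (f s) powr p"
        by (simp add: powr_mult)
    qed
  qed simp
  then have "eventually (\<lambda>n. (\<integral>s. norm ((f - v n) s) powr p \<partial>M) < \<epsilon> powr p) sequentially"
    using \<open>\<epsilon> > 0\<close> by (intro order_tendstoD(2)) auto
  then obtain n where n: "(\<integral>s. norm ((f - v n) s) powr p \<partial>M) < \<epsilon> powr p"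
    by (auto simp: eventually_sequentially)
  have "Lp_bochner_norm M p (f - v n) < (\<epsilon> powr p) powr (1 / p)"
    unfolding Lp_bochner_norm_def using n assms by (intro powr_less_mono2) auto
  also have "\<dots> = \<epsilon>" using assms \<open>\<epsilon> > 0\<close> by (simp add: powr_powr)
  finally have "Lp_bochner_norm M p (f - v n) < \<epsilon>" .
  moreover have "v n \<in> Lp_bochner M p"
  proof -
    have [measurable]: "(\<lambda>s. norm (v n s)) \<in> borel_measurable M"
      by (rule simple_vfun_norm_measurable[OF v])
    have le: "norm (v n s) powr p \<le> 2 powr p * norm (f s) powr p" for s
      using powr_mono2[of p, OF _ _ v_le[of n s]] assms by (simp add: powr_mult)
    have "integrable M (\<lambda>s. norm (v n s) powr p)"
    proof (rule Bochner_Integration.integrable_bound)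
      show "integrable M (\<lambda>s. 2 powr p * norm (f s) powr p)" using int by simp
      show "AE s in M. norm (norm (v n s) powr p) \<le> norm (2 powr p * norm (f s) powr p)"
        using le by (intro AE_I2) simp
    qed measurable
    then show ?thesis
      using simple_vfun_bochner_measurable[OF v] by (simp add: Lp_bochner_def)
  qed
  ultimately show "\<exists>g\<in>Lp_bochner M p. simple_vfun M g \<and> Lp_bochner_norm M p (f - g) < \<epsilon>"
    using v by blast
qed

lemma (in complete_measure) Lp_bochner_dense:
  assumes "p \<ge> 1"
  shows "kothe_bochner_dense M (Lp_real M p) (Lp_real_norm M p)
    (Lp_bochner M p :: ('a \<Rightarrow> 'x::real_normed_vector) set) (Lp_bochner_norm M p)"
  by (rule kothe_bochner_dense.intro[OF Lp_real_kothe_seminorm[OF assms]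
        kothe_bochner_dense_axioms.intro[OF Lp_bochner_eq[OF assms] Lp_bochner_norm_eq
          Lp_bochner_simple_dense[OF assms]]])

lemma L1_real_norm_add:
  assumes "f \<in> Lp_real M 1" "g \<in> Lp_real M 1" "\<And>s. 0 \<le> f s" "\<And>s. 0 \<le> g s"
  shows "Lp_real_norm M 1 (f + g) = Lp_real_norm M 1 f + Lp_real_norm M 1 g"
  using assms by (simp add: Lp_real_norm_def Lp_real_def)

section \<open>Koethe spaces as instances, and the theorem\<close>

lemma kothe_space_seminorm:
  assumes "complete_measure M" "kothe_space M E NE"
  shows "kothe_seminorm M E NE"
proof -
  interpret complete_measure M by fact
  note k = assms(2)[unfolded kothe_space_def]
  have sc: "c *\<^sub>R f \<in> E" if "f \<in> E" for f c using k that by (elim conjE) blast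
  have ind: "indicator A \<in> E" if "A \<in> fmeasurable M" for A
    using k that unfolding fmeasurable_def by (elim conjE) blast
  have solid: "\<forall>f\<in>E. \<forall>g\<in>borel_measurable M. (AE s in M. \<bar>g s\<bar> \<le> \<bar>f s\<bar>) \<longrightarrow> g \<in> E \<and> NE g \<le> NE f"
    using k by (elim conjE)
  show ?thesis
  proof
    \<comment> \<open>E contains the indicator of the empty set, hence its multiple by 0.\<close>
    show "0 \<in> E" using sc[OF ind[of "{}"], of 0] by simp
    fix f g :: "'a \<Rightarrow> real" and a :: real
    assume f: "f \<in> E"
    show "f \<in> borel_measurable M" using k f by (elim conjE) blast
    show "a *\<^sub>R f \<in> E" by (rule sc[OF f])
    show "NE (a *\<^sub>R f) = \<bar>a\<bar> * NE f" using k f by (elim conjE) blast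
    show "AE s in M. f s = 0" if "NE f = 0" using k f that by (elim conjE) blast
    show "f + g \<in> E" if "g \<in> E" using k f that by (elim conjE) blast
    show "NE (f + g) \<le> NE f + NE g" if "g \<in> E" using k f that by (elim conjE) blast
    assume "g \<in> borel_measurable M" "AE s in M. \<bar>g s\<bar> \<le> \<bar>f s\<bar>"
    with solid f show "g \<in> E" "NE g \<le> NE f" by blast+
  qed (rule ind)
qed

text \<open>Otherwise the space would be a countable union of null sets. This supplies the set A for
  the diameter two property.\<close>

lemma (in sigma_finite_measure) finite_positive_set:
  assumes "emeasure M (space M) > 0"
  obtains A where "A \<in> fmeasurable M" "emeasure M A \<noteq> 0"
proof -
  obtain A :: "nat \<Rightarrow> 'a set" where A: "range A \<subseteq> sets M" "(\<Union>i. A i) = space M" "\<And>i. emeasure M (A i) \<noteq> \<infinity>"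
    using sigma_finite by blast
  have "\<exists>i. emeasure M (A i) \<noteq> 0"
  proof (rule ccontr)
    assume "\<nexists>i. emeasure M (A i) \<noteq> 0"
    then have "(\<Union>i. A i) \<in> null_sets M" using A(1) by (intro null_sets_UN) auto
    then show False using assms A(2) by auto
  qed
  then obtain i where "emeasure M (A i) \<noteq> 0" by blast
  moreover have "A i \<in> fmeasurable M"
    using A(1) A(3)[of i] by (auto simp: fmeasurable_def less_top)
  ultimately show ?thesis using that by blast
qed

text \<open>Positive total measure is assumed for the diameter two property alone. Over a null
  measure space every norm is 0: the whole ball is then weakly open of diameter 0, whereas the two
  properties about slices hold vacuously, as no functional has norm one.\<close>

theorem theorem4p3:
  fixes M :: "'s measure"
  assumes "complete_measure M" and "sigma_finite_measure M"
  shows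
    "(\<forall>(E :: ('s \<Rightarrow> real) set) NE.
        kothe_space M E NE \<and>
        simple_dense M (kothe_bochner_norm NE) (kothe_bochner M E :: ('s \<Rightarrow> 'x::banach) set) \<longrightarrow>
          (LD2P (UNIV :: 'x set) norm \<longrightarrow> LD2P (kothe_bochner M E :: ('s \<Rightarrow> 'x) set) (kothe_bochner_norm NE)) \<and>
          (emeasure M (space M) > 0 \<longrightarrow>
             D2P (UNIV :: 'x set) norm \<longrightarrow> D2P (kothe_bochner M E :: ('s \<Rightarrow> 'x) set) (kothe_bochner_norm NE))) \<and>
     (\<forall>p::real. 1 \<le> p \<longrightarrow>
          (LD2P (UNIV :: 'x set) norm \<longrightarrow> LD2P (Lp_bochner M p :: ('s \<Rightarrow> 'x) set) (Lp_bochner_norm M p)) \<and>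
          (emeasure M (space M) > 0 \<longrightarrow>
             D2P (UNIV :: 'x set) norm \<longrightarrow> D2P (Lp_bochner M p :: ('s \<Rightarrow> 'x) set) (Lp_bochner_norm M p))) \<and>
     (SD2P (UNIV :: 'x set) norm \<longrightarrow> SD2P (Lp_bochner M 1 :: ('s \<Rightarrow> 'x) set) (Lp_bochner_norm M 1))"
proof -
  have both: "(LD2P (UNIV :: 'x set) norm \<longrightarrow> LD2P V N) \<and>
      (emeasure M (space M) > 0 \<longrightarrow> D2P (UNIV :: 'x set) norm \<longrightarrow> D2P V N)"
    if "kothe_bochner_dense M E NE V N" for E NE and V :: "('s \<Rightarrow> 'x) set" and N
  proof -
    interpret kothe_bochner_dense M E NE V N by fact
    show ?thesis
      using LD2P_kothe_bochner D2P_kothe_bochner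
        sigma_finite_measure.finite_positive_set[OF assms(2)] by metis
  qed
  have "kothe_bochner_dense M E NE (kothe_bochner M E :: ('s \<Rightarrow> 'x) set) (kothe_bochner_norm NE)"
    if "kothe_space M E NE" "simple_dense M (kothe_bochner_norm NE) (kothe_bochner M E :: ('s \<Rightarrow> 'x) set)"
    for E NE
    by (rule kothe_bochner_dense.intro[OF kothe_space_seminorm[OF assms(1) that(1)]
          kothe_bochner_dense_axioms.intro[OF refl refl that(2)]])
  moreover have Lp: "kothe_bochner_dense M (Lp_real M p) (Lp_real_norm M p)
      (Lp_bochner M p :: ('s \<Rightarrow> 'x) set) (Lp_bochner_norm M p)" if "1 \<le> p" for p
    by (rule complete_measure.Lp_bochner_dense[OF assms(1) that])
  moreover have "SD2P (Lp_bochner M 1 :: ('s \<Rightarrow> 'x) set) (Lp_bochner_norm M 1)" if "SD2P (UNIV :: 'x set) norm"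
    by (rule kothe_bochner_dense.SD2P_kothe_bochner[OF Lp[OF order_refl] that L1_real_norm_add])
  ultimately show ?thesis
    using both by (intro conjI allI impI; (elim conjE)?; blast)
qed

end
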